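(* Let $f,g,Q,L,\phi_1,\phi_2,\alpha_1,\alpha_2,\{\alpha_{1k}\},\{\alpha_{2k}\},\{\beta_{1k}\},\{\beta_{2k}\}$ satisfy the standing assumptions of the context, let $\{(x_k,y_k)\}_{k\in\mathbb N}$ be any sequence generated by the two-step inertial Bregman proximal alternating linearized minimization scheme defined in the context, and write $z_k=(x_k,y_k)$. Let $\rho=\min\{\theta_1-L_1^+,\theta_2-L_2^+\}$ and assume $2(\alpha_1+\alpha_2)<\rho$. Suppose that $L$ is coercive. Let $H:\mathbb R^{3(l+m)}\to(-\infty,+\infty]$ be $$H(u,v,w)=L(u)+\frac{\alpha_1+\alpha_2}{2}\|u-v\|_2^2+\frac{\alpha_2}{2}\|v-w\|_2^2,\qquad u,v,w\in\mathbb R^l\times\mathbb R^m .$$ Then the sequence $u_k:=(z_k,z_{k-1},z_{k-2})$, $k\ge 0$, satisfies the following three conditions for some constants $a,b>0$ (with $\triangle_k=\|z_k-z_{k-1}\|_2$): (H1) for every $k\ge 0$, $H(u_{k+1})+a\triangle_{k+1}^2\le H(u_k)$; (H2) for every $k\ge 0$ there exists $w_{k+1}\in\partial H(u_{k+1})$ with $\|w_{k+1}\|_2\le b(\triangle_{k+1}+\triangle_k+\triangle_{k-1})$; (H3) there exist a subsequence $\{u_{k_j}\}_{j\in\mathbb N}$ and a point $\tilde u$ such that $u_{k_j}\to\tilde u$ and $H(u_{k_j})\to H(\tilde u)$ as $j\to\infty$. Moreover, if $H$ has the Kurdyka--Łojasiewicz property at a cluster point $(z^\ast,z^\ast,z^\ast)$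 of the sequence $\{(z_{k+1},z_k,z_{k-1})\}_{k\in\mathbb N}$, then $\{z_k\}_{k\in\mathbb N}$ has finite length, i.e. $\sum_{k=0}^\infty\|z_{k+1}-z_k\|_2<+\infty$, $z_k\to z^\ast$ as $k\to\infty$, and $(z^\ast,z^\ast,z^\ast)$ is a critical point of $H$; hence $z^\ast$ is a critical point of $L$.
   Context: Problem. $L(x,y)=f(x)+Q(x,y)+g(y)$ for $(x,y)\in\mathbb R^l\times\mathbb R^m$, where $f:\mathbb R^l\to(-\infty,+\infty]$ and $g:\mathbb R^m\to(-\infty,+\infty]$ are proper and lower semicontinuous (not necessarily convex), $Q:\mathbb R^l\times\mathbb R^m\to\mathbb R$ is continuously differentiable with $\nabla Q$ Lipschitz continuous on bounded subsets, and $\inf L>-\infty$, $\inf f>-\infty$, $\inf g>-\infty$. Bregman distances. $\phi_1:\mathbb R^l\to\mathbb R$ and $\phi_2:\mathbb R^m\to\mathbb R$ are differentiable, $\phi_i$ is $\theta_i$-strongly convex with $\theta_i>0$ (i.e. $\phi_i-\frac{\theta_i}{2}\|\cdot\|_2^2$ is convex), and $\nabla\phi_i$ is Lipschitz continuous with constant $L_{\nabla\phi_i}$, $i=1,2$. The Bregman distance is $D_\phi(x,y)=\phi(x)-\phi(y)-\langle\nabla\phi(y),x-y\rangle$. Scheme. Let $\alpha_1,\alpha_2\ge 0$, $\{\alpha_{1k}\},\{\beta_{1k}\}\subseteq[0,\alpha_1]$, $\{\alpha_{2k}\},\{\beta_{2k}\}\subseteq[0,\alpha_2]$. Choose $(x_0,y_0)\in\mathrm{dom}\,L$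 and set $(x_{-i},y_{-i})=(x_0,y_0)$ for $i=1,2$. For $k\ge 0$, choose $$x_{k+1}\in\arg\min_{x\in\mathbb R^l}\{f(x)+\langle x,\nabla_xQ(x_k,y_k)\rangle+D_{\phi_1}(x,x_k)+\alpha_{1k}\langle x,x_{k-1}-x_k\rangle+\alpha_{2k}\langle x,x_{k-2}-x_{k-1}\rangle\},$$ $$y_{k+1}\in\arg\min_{y\in\mathbb R^m}\{g(y)+\langle y,\nabla_yQ(x_{k+1},y_k)\rangle+D_{\phi_2}(y,y_k)+\beta_{1k}\langle y,y_{k-1}-y_k\rangle+\beta_{2k}\langle y,y_{k-2}-y_{k-1}\rangle\}.$$ Standing assumptions on the gradients. For each fixed $y$, $x\mapsto\nabla_xQ(x,y)$ is globally Lipschitz on $\mathbb R^l$ with constant $L_1(y)$; for each fixed $x$, $y\mapsto\nabla_yQ(x,y)$ is globally Lipschitz on $\mathbb R^m$ with constant $L_2(x)$. There are constants $L_1^+,L_2^+>0$ with $\sup_{k\in\mathbb N}L_1(y_k)\le L_1^+$ and $\sup_{k\in\mathbb N}L_2(x_k)\le L_2^+$, and $\theta_1>L_1^+$, $\theta_2>L_2^+$. Notation. $\mathbb N$ includes $0$. $\triangle_k=\|z_k-z_{k-1}\|_2$ (for $k\ge -1$; $\triangle_0=\triangle_{-1}=0$). Coercive means $L(z)\to+\infty$ as $\|z\|_2\to\infty$. Subdifferential. For $F:\mathbb R^d\to(-\infty,+\infty]$ proper lower semicontinuous and $x\in\mathrm{dom}\,F$, the Fréchet subdifferential $\hat\partial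 F(x)$ is the set of $v$ with $\liminf_{y\to x}\frac{F(y)-F(x)-\langle v,y-x\rangle}{\|x-y\|_2}\ge 0$ (and $\hat\partial F(x)=\emptyset$ if $x\notin\mathrm{dom}\,F$). The (limiting) subdifferential is $\partial F(x)=\{v:\exists x_k\to x,\ F(x_k)\to F(x),\ v_k\in\hat\partial F(x_k),\ v_k\to v\}$. A critical point of $F$ is a point $x$ with $0\in\partial F(x)$. Kurdyka--Łojasiewicz (KL) property. $F$ has the KL property at $x^\ast\in\mathrm{dom}\,F$ if there exist $\eta\in(0,+\infty]$, a neighborhood $U$ of $x^\ast$ and a continuous concave function $\varphi:[0,\eta)\to\mathbb R_+$ with $\varphi(0)=0$, $\varphi\in C^1(0,\eta)$, $\varphi'>0$ on $(0,\eta)$, such that $\varphi'(F(x)-F(x^\ast))\,\mathrm{dist}(0,\partial F(x))\ge 1$ for all $x\in U$ with $F(x^\ast)<F(x)<F(x^\ast)+\eta$. *)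

theory Defs
  imports "HOL-Analysis.Analysis"
begin

definition proper_fun :: "('a \<Rightarrow> ereal) \<Rightarrow> bool" where
  "proper_fun F \<longleftrightarrow> (\<forall>x. F x \<noteq> -\<infinity>) \<and> (\<exists>x. F x < \<infinity>)"

definition edom :: "('a \<Rightarrow> ereal) \<Rightarrow> 'a set" where
  "edom F = {x. F x < \<infinity>}"

definition lsc :: "('a::topological_space \<Rightarrow> ereal) \<Rightarrow> bool" where
  "lsc F \<longleftrightarrow> (\<forall>x. F x \<le> Liminf (at x) F)"

definition coercive :: "('a::real_normed_vector \<Rightarrow> ereal) \<Rightarrow> bool" where
  "coercive F \<longleftrightarrow> (F \<longlongrightarrow> \<infinity>) at_infinity"

definition grad :: "('a::euclidean_space \<Rightarrow> real) \<Rightarrow> 'a \<Rightarrow> 'a" where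
  "grad f x = (THE D. GDERIV f x :> D)"

definition grad_fst :: "('a::euclidean_space \<times> 'b::euclidean_space \<Rightarrow> real) \<Rightarrow> 'a \<Rightarrow> 'b \<Rightarrow> 'a" where
  "grad_fst Q x y = grad (\<lambda>x'. Q (x', y)) x"

definition grad_snd :: "('a::euclidean_space \<times> 'b::euclidean_space \<Rightarrow> real) \<Rightarrow> 'a \<Rightarrow> 'b \<Rightarrow> 'b" where
  "grad_snd Q x y = grad (\<lambda>y'. Q (x, y')) y"

definition C1 :: "('a::euclidean_space \<Rightarrow> real) \<Rightarrow> bool" where
  "C1 f \<longleftrightarrow> (\<forall>x. f differentiable (at x)) \<and> continuous_on UNIV (grad f)"

definition lipschitz_on_bounded :: "('a::metric_space \<Rightarrow> 'b::metric_space) \<Rightarrow> bool" where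
  "lipschitz_on_bounded f \<longleftrightarrow> (\<forall>B. bounded B \<longrightarrow> (\<exists>C. C-lipschitz_on B f))"

definition strongly_convex :: "real \<Rightarrow> ('a::euclidean_space \<Rightarrow> real) \<Rightarrow> bool" where
  "strongly_convex \<theta> \<phi> \<longleftrightarrow> convex_on UNIV (\<lambda>x. \<phi> x - \<theta> / 2 * (norm x)\<^sup>2)"

definition bregman :: "('a::euclidean_space \<Rightarrow> real) \<Rightarrow> 'a \<Rightarrow> 'a \<Rightarrow> real" where
  "bregman \<phi> x y = \<phi> x - \<phi> y - grad \<phi> y \<bullet> (x - y)"

definition frechet_subdiff :: "('a::euclidean_space \<Rightarrow> ereal) \<Rightarrow> 'a \<Rightarrow> 'a set" where
  "frechet_subdiff F x = {v. x \<in> edom F \<and>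
     0 \<le> Liminf (at x) (\<lambda>y. (F y - F x - ereal (v \<bullet> (y - x))) / ereal (norm (x - y)))}"

definition limiting_subdiff :: "('a::euclidean_space \<Rightarrow> ereal) \<Rightarrow> 'a \<Rightarrow> 'a set" where
  "limiting_subdiff F x = {v. x \<in> edom F \<and>
     (\<exists>X V. X \<longlonglongrightarrow> x \<and> (\<lambda>n. F (X n)) \<longlonglongrightarrow> F x \<and>
            (\<forall>n. V n \<in> frechet_subdiff F (X n)) \<and> V \<longlonglongrightarrow> v)}"

definition critical_point :: "('a::euclidean_space \<Rightarrow> ereal) \<Rightarrow> 'a \<Rightarrow> bool" where
  "critical_point F x \<longleftrightarrow> 0 \<in> limiting_subdiff F x"

text \<open>Unlike \<open>infdist\<close>, which is \<open>0\<close> on the empty set, this distance takes the value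
  \<open>\<infinity>\<close> there, as is usual in the Kurdyka--Lojasiewicz inequality.\<close>

definition edist :: "'a::metric_space \<Rightarrow> 'a set \<Rightarrow> ereal" where
  "edist x S = (INF v\<in>S. ereal (dist x v))"

definition KL_property :: "('a::euclidean_space \<Rightarrow> ereal) \<Rightarrow> 'a \<Rightarrow> bool" where
  "KL_property F p \<longleftrightarrow> p \<in> edom F \<and>
     (\<exists>(\<eta>::ereal) U (\<phi>::real \<Rightarrow> real) \<phi>'.
        0 < \<eta> \<and> open U \<and> p \<in> U \<and>
        continuous_on {t. 0 \<le> t \<and> ereal t < \<eta>} \<phi> \<and>
        concave_on {t. 0 \<le> t \<and> ereal t < \<eta>} \<phi> \<and>
        (\<forall>t. 0 \<le> t \<and> ereal t < \<eta> \<longrightarrow> 0 \<le> \<phi> t) \<and>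
        \<phi> 0 = 0 \<and>
        (\<forall>t. 0 < t \<and> ereal t < \<eta> \<longrightarrow> (\<phi> has_real_derivative \<phi>' t) (at t)) \<and>
        continuous_on {t. 0 < t \<and> ereal t < \<eta>} \<phi>' \<and>
        (\<forall>t. 0 < t \<and> ereal t < \<eta> \<longrightarrow> 0 < \<phi>' t) \<and>
        (\<forall>x\<in>U. F p < F x \<and> F x < F p + \<eta> \<longrightarrow>
           1 \<le> ereal (\<phi>' (real_of_ereal (F x - F p))) * edist 0 (limiting_subdiff F x)))"

definition seq_cluster_point :: "(nat \<Rightarrow> 'a::topological_space) \<Rightarrow> 'a \<Rightarrow> bool" where
  "seq_cluster_point s p \<longleftrightarrow> (\<exists>r. strict_mono r \<and> (s \<circ> r) \<longlonglongrightarrow> p)"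

definition objective ::
  "('a \<Rightarrow> ereal) \<Rightarrow> ('a \<times> 'b \<Rightarrow> real) \<Rightarrow> ('b \<Rightarrow> ereal) \<Rightarrow> 'a \<times> 'b \<Rightarrow> ereal" where
  "objective f Q g = (\<lambda>(x, y). f x + ereal (Q (x, y)) + g y)"

text \<open>Iterates are indexed by \<^typ>\<open>nat\<close>. Since subtraction on \<^typ>\<open>nat\<close> truncates at \<open>0\<close>, the
  terms \<open>x (k - 1)\<close> and \<open>x (k - 2)\<close> equal \<open>x 0\<close> whenever the index would be negative: this is
  exactly the initialisation convention setting the iterates with index -1 and -2 to the
  iterate with index 0. The same applies to \<open>prev_step\<close> (the steps with index 0 and -1 vanish)
  and to \<open>lifted_seq\<close>.\<close>

definition inertial_scheme ::
  "('a::euclidean_space \<Rightarrow> ereal) \<Rightarrow> ('a \<times> 'b::euclidean_space \<Rightarrow> real) \<Rightarrow> ('b \<Rightarrow> ereal) \<Rightarrow>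
   ('a \<Rightarrow> real) \<Rightarrow> ('b \<Rightarrow> real) \<Rightarrow>
   (nat \<Rightarrow> real) \<Rightarrow> (nat \<Rightarrow> real) \<Rightarrow> (nat \<Rightarrow> real) \<Rightarrow> (nat \<Rightarrow> real) \<Rightarrow>
   (nat \<Rightarrow> 'a) \<Rightarrow> (nat \<Rightarrow> 'b) \<Rightarrow> bool" where
  "inertial_scheme f Q g \<phi>1 \<phi>2 \<alpha>1s \<alpha>2s \<beta>1s \<beta>2s x y \<longleftrightarrow>
     (x 0, y 0) \<in> edom (objective f Q g) \<and>
     (\<forall>k. is_arg_min
            (\<lambda>v. f v + ereal (v \<bullet> grad_fst Q (x k) (y k) + bregman \<phi>1 v (x k)
                 + \<alpha>1s k * (v \<bullet> (x (k - 1) - x k))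
                 + \<alpha>2s k * (v \<bullet> (x (k - 2) - x (k - 1)))))
            (\<lambda>_. True) (x (k + 1))) \<and>
     (\<forall>k. is_arg_min
            (\<lambda>v. g v + ereal (v \<bullet> grad_snd Q (x (k + 1)) (y k) + bregman \<phi>2 v (y k)
                 + \<beta>1s k * (v \<bullet> (y (k - 1) - y k))
                 + \<beta>2s k * (v \<bullet> (y (k - 2) - y (k - 1)))))
            (\<lambda>_. True) (y (k + 1)))"

definition prev_step :: "(nat \<Rightarrow> 'a::real_normed_vector) \<Rightarrow> nat \<Rightarrow> real" where
  "prev_step z k = norm (z k - z (k - 1))"

definition lifted_seq :: "(nat \<Rightarrow> 'a) \<Rightarrow> nat \<Rightarrow> 'a \<times> 'a \<times> 'a" where
  "lifted_seq z k = (z k, z (k - 1), z (k - 2))"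

definition merit ::
  "real \<Rightarrow> real \<Rightarrow> ('a::real_normed_vector \<Rightarrow> ereal) \<Rightarrow> 'a \<times> 'a \<times> 'a \<Rightarrow> ereal" where
  "merit \<alpha>1 \<alpha>2 L = (\<lambda>(u, v, w).
     L u + ereal ((\<alpha>1 + \<alpha>2) / 2 * (norm (u - v))\<^sup>2) + ereal (\<alpha>2 / 2 * (norm (v - w))\<^sup>2))"

end

theory Submission
  imports Defs
begin

text \<open>
  Testing the minimality of each new iterate against the previous one, and combining the descent
  lemma for \<open>Q\<close>, the strong convexity of \<open>\<phi>\<^sub>i\<close> and Young's inequality for the inertial terms, gives
  (H1) with \<open>a = \<rho> / 2 - (\<alpha>\<^sub>1 + \<alpha>\<^sub>2)\<close>. In particular the steps tend to \<open>0\<close>, and by coercivity the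
  iterates are bounded. Fermat's rule for the two subproblems yields explicit Frechet subgradients
  of \<open>L\<close> and \<open>H\<close> at the iterates, whose norms are controlled by the last three steps because all
  gradients involved are Lipschitz on the bounded set of iterates; this is (H2). Testing minimality
  against a cluster point shows that the values of \<open>f\<close> and \<open>g\<close> converge along the subsequence, which
  is (H3). Under the KL inequality, (H1), (H2) and the concavity of the desingularising function
  bound \<open>4 \<triangle>\<^sub>k\<^sub>+\<^sub>1\<close> by \<open>\<triangle>\<^sub>k + \<triangle>\<^sub>k\<^sub>-\<^sub>1 + \<triangle>\<^sub>k\<^sub>-\<^sub>2\<close> plus a telescoping term as long as the iterates stay near
  the cluster point, and this forces them to stay there. Criticality for \<open>L\<close> is
  obtained directly from the Frechet subgradients of \<open>L\<close>, without a calculus rule relating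
  \<open>\<partial>H\<close> to \<open>\<partial>L\<close>.
\<close>

subsection \<open>Gradients\<close>

lemma GDERIV_unique:
  fixes f :: "'a::euclidean_space \<Rightarrow> real"
  assumes "GDERIV f x :> D" "GDERIV f x :> E"
  shows "D = E"
proof -
  have "(\<lambda>h. h \<bullet> D) = (\<lambda>h. h \<bullet> E)"
    using assms unfolding gderiv_def by (rule has_derivative_unique)
  then have "\<forall>h. h \<bullet> D = h \<bullet> E"
    by (simp add: fun_eq_iff)
  then show ?thesis
    by (rule vector_eq_ldot[THEN iffD1])
qed

lemma grad_eqI:
  fixes f :: "'a::euclidean_space \<Rightarrow> real"
  shows "GDERIV f x :> D \<Longrightarrow> grad f x = D"
  unfolding grad_def by (blast intro: GDERIV_unique the_equality)

text \<open>A linear functional on a Euclidean space is the inner product with the vector of its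
  values on \<open>Basis\<close>. So the definite description behind \<open>grad\<close> denotes the
  gradient wherever the function is differentiable.\<close>

lemma GDERIV_grad:
  fixes f :: "'a::euclidean_space \<Rightarrow> real"
  assumes "f differentiable (at x)"
  shows "GDERIV f x :> grad f x"
proof -
  obtain f' where f': "(f has_derivative f') (at x)"
    using assms by (auto simp: differentiable_def)
  define D where "D = (\<Sum>b\<in>Basis. f' b *\<^sub>R b)"
  have lin: "linear f'"
    using f' by (rule has_derivative_linear)
  have "f' h = h \<bullet> D" for h
  proof -
    have "f' h = f' (\<Sum>b\<in>Basis. (h \<bullet> b) *\<^sub>R b)"
      by (simp add: euclidean_representation)
    also have "\<dots> = h \<bullet> D"
      by (simp add: D_def linear_sum[OF lin] linear_scale[OF lin] inner_sum_right mult.commute)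
    finally show ?thesis .
  qed
  then have "f' = (\<lambda>h. h \<bullet> D)"
    by auto
  with f' have "GDERIV f x :> D"
    by (simp add: gderiv_def)
  then show ?thesis
    by (simp add: grad_eqI)
qed

lemma GDERIV_partial_fst:
  fixes Q :: "'a::euclidean_space \<times> 'b::euclidean_space \<Rightarrow> real"
  assumes "GDERIV Q (x, y) :> D"
  shows "GDERIV (\<lambda>x'. Q (x', y)) x :> fst D"
proof -
  have *: "((\<lambda>x'. (x', y)) has_derivative (\<lambda>h. (h, 0))) (at x)"
    by (auto intro!: derivative_eq_intros)
  have "((\<lambda>x'. Q (x', y)) has_derivative (\<lambda>h. (h, 0) \<bullet> D)) (at x)"
    using has_derivative_compose[OF * assms[unfolded gderiv_def]] .
  then show ?thesis
    by (simp add: gderiv_def inner_prod_def)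
qed

lemma GDERIV_partial_snd:
  fixes Q :: "'a::euclidean_space \<times> 'b::euclidean_space \<Rightarrow> real"
  assumes "GDERIV Q (x, y) :> D"
  shows "GDERIV (\<lambda>y'. Q (x, y')) y :> snd D"
proof -
  have *: "((\<lambda>y'. (x, y')) has_derivative (\<lambda>h. (0, h))) (at y)"
    by (auto intro!: derivative_eq_intros)
  have "((\<lambda>y'. Q (x, y')) has_derivative (\<lambda>h. (0, h) \<bullet> D)) (at y)"
    using has_derivative_compose[OF * assms[unfolded gderiv_def]] .
  then show ?thesis
    by (simp add: gderiv_def inner_prod_def)
qed

lemma grad_fst_eq:
  assumes "Q differentiable (at (x, y))"
  shows "grad_fst Q x y = fst (grad Q (x, y))"
  unfolding grad_fst_def by (intro grad_eqI GDERIV_partial_fst GDERIV_grad assms)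

lemma grad_snd_eq:
  assumes "Q differentiable (at (x, y))"
  shows "grad_snd Q x y = snd (grad Q (x, y))"
  unfolding grad_snd_def by (intro grad_eqI GDERIV_partial_snd GDERIV_grad assms)

text \<open>This and the next lemma give the gradients of the two quadratic coupling terms of
  \<open>merit\<close>.\<close>

lemma GDERIV_half_norm_sq_diff12:
  fixes p :: "'a::euclidean_space \<times> 'a \<times> 'b::euclidean_space"
  shows "GDERIV (\<lambda>p. c / 2 * (norm (fst p - fst (snd p)))\<^sup>2) p
    :> (c *\<^sub>R (fst p - fst (snd p)), - c *\<^sub>R (fst p - fst (snd p)), 0)"
  unfolding gderiv_def power2_norm_eq_inner
  by (auto intro!: derivative_eq_intros simp: inner_prod_def inner_commute algebra_simps)

lemma GDERIV_half_norm_sq_diff23: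
  fixes p :: "'b::euclidean_space \<times> 'a::euclidean_space \<times> 'a"
  shows "GDERIV (\<lambda>p. c / 2 * (norm (fst (snd p) - snd (snd p)))\<^sup>2) p
    :> (0, c *\<^sub>R (fst (snd p) - snd (snd p)), - c *\<^sub>R (fst (snd p) - snd (snd p)))"
  unfolding gderiv_def power2_norm_eq_inner
  by (auto intro!: derivative_eq_intros simp: inner_prod_def inner_commute algebra_simps)

lemma DERIV_along_line:
  fixes f :: "'a::euclidean_space \<Rightarrow> real"
  assumes "GDERIV f (v + t *\<^sub>R d) :> D"
  shows "((\<lambda>t. f (v + t *\<^sub>R d)) has_real_derivative d \<bullet> D) (at t)"
proof -
  have *: "((\<lambda>t. v + t *\<^sub>R d) has_derivative (\<lambda>h. h *\<^sub>R d)) (at t)"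
    by (auto intro!: derivative_eq_intros)
  have "((\<lambda>t. f (v + t *\<^sub>R d)) has_derivative (\<lambda>h. (h *\<^sub>R d) \<bullet> D)) (at t)"
    using has_derivative_compose[OF * assms[unfolded gderiv_def]] .
  then show ?thesis
    by (simp add: has_field_derivative_def mult_commute_abs)
qed

text \<open>On the segment from \<open>v\<close> to \<open>u\<close>, subtracting the linear and the
  quadratic term from \<open>f\<close> leaves a function \<open>h\<close> whose derivative is
  nonpositive by Cauchy-Schwarz and the Lipschitz bound. Monotonicity of \<open>h\<close> replaces
  an integral of the gradient.\<close>

lemma descent_lemma:
  fixes f :: "'a::euclidean_space \<Rightarrow> real"
  assumes diff: "\<And>x. f differentiable (at x)"
    and lip: "C-lipschitz_on UNIV (grad f)"
  shows "f u \<le> f v + grad f v \<bullet> (u - v) + C / 2 * (norm (u - v))\<^sup>2"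
proof -
  define d where "d = u - v"
  define h where "h t = f (v + t *\<^sub>R d) - t * (d \<bullet> grad f v) - C / 2 * t\<^sup>2 * (norm d)\<^sup>2" for t
  have "h 0 \<ge> h 1"
  proof (rule DERIV_nonpos_imp_nonincreasing[where f = h])
    fix t :: real assume t: "0 \<le> t" "t \<le> 1"
    have "(h has_real_derivative
        d \<bullet> grad f (v + t *\<^sub>R d) - d \<bullet> grad f v - C * t * (norm d)\<^sup>2) (at t)"
      unfolding h_def
      by (auto intro!: derivative_eq_intros DERIV_along_line[OF GDERIV_grad[OF diff]])
    moreover have "d \<bullet> grad f (v + t *\<^sub>R d) - d \<bullet> grad f v \<le> C * t * (norm d)\<^sup>2"
    proof -
      have "d \<bullet> grad f (v + t *\<^sub>R d) - d \<bullet> grad f v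
          \<le> norm d * norm (grad f (v + t *\<^sub>R d) - grad f v)"
        by (metis inner_diff_right norm_cauchy_schwarz)
      also have "\<dots> \<le> norm d * (C * norm (t *\<^sub>R d))"
        using lipschitz_onD[OF lip, of "v + t *\<^sub>R d" v]
        by (intro mult_left_mono) (auto simp: dist_norm)
      finally show ?thesis
        using t by (simp add: power2_eq_square algebra_simps)
    qed
    ultimately show "\<exists>y. (h has_real_derivative y) (at t) \<and> y \<le> 0"
      by force
  qed simp
  then show ?thesis
    by (simp add: h_def d_def inner_commute)
qed

text \<open>Removing the quadratic from \<open>\<phi>\<close> leaves the convex
  \<open>\<psi>\<close>. Along the line through \<open>v\<close> and \<open>u\<close> it lies above
  its tangent at \<open>v\<close>, and expanding the squares turns this into the claim.\<close>

lemma bregman_lower_bound: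
  assumes diff: "\<And>x. \<phi> differentiable (at x)" and sc: "strongly_convex \<theta> \<phi>"
  shows "\<theta> / 2 * (norm (u - v))\<^sup>2 \<le> bregman \<phi> u v"
proof -
  define d where "d = u - v"
  define \<psi> where "\<psi> x = \<phi> x - \<theta> / 2 * (norm x)\<^sup>2" for x
  have conv: "convex_on UNIV (\<lambda>t. \<psi> (v + t *\<^sub>R d))"
  proof (rule convex_onI)
    fix t a b :: real assume t: "0 < t" "t < 1"
    have "\<psi> (v + ((1 - t) *\<^sub>R a + t *\<^sub>R b) *\<^sub>R d)
        = \<psi> ((1 - t) *\<^sub>R (v + a *\<^sub>R d) + t *\<^sub>R (v + b *\<^sub>R d))"
      by (simp add: algebra_simps)
    also have "\<dots> \<le> (1 - t) * \<psi> (v + a *\<^sub>R d) + t * \<psi> (v + b *\<^sub>R d)"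
      using sc t unfolding strongly_convex_def \<psi>_def by (intro convex_onD) auto
    finally show "\<psi> (v + ((1 - t) *\<^sub>R a + t *\<^sub>R b) *\<^sub>R d)
        \<le> (1 - t) * \<psi> (v + a *\<^sub>R d) + t * \<psi> (v + b *\<^sub>R d)" .
  qed simp
  have "GDERIV \<psi> (v + 0 *\<^sub>R d) :> grad \<phi> v - \<theta> *\<^sub>R v"
  proof -
    have "(\<phi> has_derivative (\<lambda>h. h \<bullet> grad \<phi> v)) (at v)"
      using GDERIV_grad[OF diff] by (simp add: gderiv_def)
    then show ?thesis
      unfolding \<psi>_def gderiv_def power2_norm_eq_inner
      by (auto intro!: derivative_eq_intros simp: inner_commute algebra_simps)
  qed
  from DERIV_along_line[OF this] convex_on_imp_above_tangent[OF conv connected_UNIV, of 0 1]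
  have "d \<bullet> (grad \<phi> v - \<theta> *\<^sub>R v) \<le> \<psi> (v + d) - \<psi> v"
    by auto
  then show ?thesis
    by (simp add: \<psi>_def bregman_def d_def power2_norm_eq_inner inner_commute algebra_simps)
qed

lemma GDERIV_bregman:
  assumes "\<phi> differentiable (at u)"
  shows "GDERIV (\<lambda>u. bregman \<phi> u v) u :> grad \<phi> u - grad \<phi> v"
proof -
  have "(\<phi> has_derivative (\<lambda>h. h \<bullet> grad \<phi> u)) (at u)"
    using GDERIV_grad[OF assms] by (simp add: gderiv_def)
  then show ?thesis
    unfolding bregman_def gderiv_def
    by (auto intro!: derivative_eq_intros simp: inner_commute algebra_simps)
qed

subsection \<open>Frechet subdifferentials\<close>

text \<open>The neighbourhood filter may be used in place of the punctured one, as the inequality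
  is trivial at \<^term>\<open>x\<close>.\<close>

lemma frechet_subdiff_iff:
  assumes "F x = ereal r"
  shows "v \<in> frechet_subdiff F x \<longleftrightarrow>
    (\<forall>e>0. \<forall>\<^sub>F y in nhds x. ereal (r + v \<bullet> (y - x) - e * norm (y - x)) \<le> F y)"
    (is "?l \<longleftrightarrow> ?r")
proof -
  let ?q = "\<lambda>y. (F y - F x - ereal (v \<bullet> (y - x))) / ereal (norm (x - y))"
  have q: "ereal c < ?q y \<longleftrightarrow> ereal (r + v \<bullet> (y - x) + c * norm (y - x)) < F y"
    if "y \<noteq> x" for y c
  proof -
    have pos: "0 < norm (x - y)" using that by simp
    show ?thesis
      using pos assms by (cases "F y") (auto simp: less_divide_eq field_simps norm_minus_commute)
  qed
  have "?l \<longleftrightarrow> 0 \<le> Liminf (at x) ?q"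
    using assms by (simp add: frechet_subdiff_def edom_def)
  also have "\<dots> \<longleftrightarrow> (\<forall>c<0. \<forall>\<^sub>F y in at x. c < ?q y)"
    by (rule le_Liminf_iff)
  also have "\<dots> \<longleftrightarrow> (\<forall>e>0. \<forall>\<^sub>F y in at x. ereal (-e) < ?q y)"
  proof (intro iffI allI impI)
    fix e :: real assume *: "\<forall>c<0. \<forall>\<^sub>F y in at x. c < ?q y" and "0 < e"
    then show "\<forall>\<^sub>F y in at x. ereal (-e) < ?q y"
      by (simp add: zero_ereal_def)
  next
    fix c :: ereal assume *: "\<forall>e>0. \<forall>\<^sub>F y in at x. ereal (-e) < ?q y" and c: "c < 0"
    \<comment> \<open>A threshold \<open>c\<close> of minus infinity is implied by any real one, so
      \<open>e = 1\<close> serves there.\<close>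
    obtain e where e: "0 < e" "c \<le> ereal (- e)"
    proof (cases c)
      case (real d) with c that[of "-d"] show thesis by auto
    next
      case MInf with that[of 1] show thesis by auto
    qed (use c in auto)
    from * e(1) have "\<forall>\<^sub>F y in at x. ereal (-e) < ?q y" by blast
    then show "\<forall>\<^sub>F y in at x. c < ?q y"
      by (rule eventually_mono) (use e(2) in auto)
  qed
  also have "\<dots> \<longleftrightarrow> (\<forall>e>0. \<forall>\<^sub>F y in at x. ereal (r + v \<bullet> (y - x) - e * norm (y - x)) < F y)"
  proof -
    have "(\<forall>\<^sub>F y in at x. ereal (-e) < ?q y)
        \<longleftrightarrow> (\<forall>\<^sub>F y in at x. ereal (r + v \<bullet> (y - x) - e * norm (y - x)) < F y)" for e
      unfolding eventually_at_filter using q[of _ "- e"] by (simp cong: conj_cong imp_cong)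
    then show ?thesis by simp
  qed
  also have "\<dots> \<longleftrightarrow> ?r"
  proof (intro iffI allI impI)
    fix e :: real
    assume *: "\<forall>e>0. \<forall>\<^sub>F y in at x. ereal (r + v \<bullet> (y - x) - e * norm (y - x)) < F y" and "0 < e"
    then have "\<forall>\<^sub>F y in at x. ereal (r + v \<bullet> (y - x) - e * norm (y - x)) < F y"
      by blast
    then show "\<forall>\<^sub>F y in nhds x. ereal (r + v \<bullet> (y - x) - e * norm (y - x)) \<le> F y"
      unfolding eventually_at_filter
      by (rule eventually_mono) (use assms less_imp_le in fastforce)
  next
    fix e :: real
    assume *: ?r and e: "0 < e"
    \<comment> \<open>Spending only half of the slack leaves a positive margin at
      \<open>y \<noteq> x\<close>, which makes the inequality strict again.\<close>
    then have "\<forall>\<^sub>F y in nhds x. ereal (r + v \<bullet> (y - x) - (e/2) * norm (y - x)) \<le> F y"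
      using half_gt_zero by blast
    then show "\<forall>\<^sub>F y in at x. ereal (r + v \<bullet> (y - x) - e * norm (y - x)) < F y"
      unfolding eventually_at_filter
    proof (rule eventually_mono, intro impI)
      fix y assume le: "ereal (r + v \<bullet> (y - x) - (e/2) * norm (y - x)) \<le> F y" and "y \<noteq> x"
      then have "r + v \<bullet> (y - x) - e * norm (y - x) < r + v \<bullet> (y - x) - (e/2) * norm (y - x)"
        using e by simp
      with le show "ereal (r + v \<bullet> (y - x) - e * norm (y - x)) < F y"
        by (meson less_ereal.simps(1) less_le_trans)
    qed
  qed
  finally show ?thesis .
qed

text \<open>The two lower bounds, each with slack \<open>e/2\<close>, add up. This direction of the
  sum rule needs no smoothness, only finite values at \<open>x\<close>.\<close>

lemma frechet_subdiff_add:
  assumes r: "F x = ereal r" and s: "G x = ereal s"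
    and v: "v \<in> frechet_subdiff F x" and w: "w \<in> frechet_subdiff G x"
  shows "v + w \<in> frechet_subdiff (\<lambda>y. F y + G y) x"
proof -
  have rs: "F x + G x = ereal (r + s)"
    using r s by simp
  show ?thesis
    unfolding frechet_subdiff_iff[where F = "\<lambda>y. F y + G y", OF rs]
  proof (intro allI impI)
    fix e :: real assume "0 < e"
    then have "\<forall>\<^sub>F y in nhds x. ereal (r + v \<bullet> (y - x) - (e/2) * norm (y - x)) \<le> F y"
      "\<forall>\<^sub>F y in nhds x. ereal (s + w \<bullet> (y - x) - (e/2) * norm (y - x)) \<le> G y"
      using v w r s by (auto simp: frechet_subdiff_iff simp del: times_divide_eq_left)
    then show "\<forall>\<^sub>F y in nhds x. ereal (r + s + (v + w) \<bullet> (y - x) - e * norm (y - x)) \<le> F y + G y"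
    proof eventually_elim
      case (elim y)
      from add_mono[OF this] show ?case
        by (simp add: algebra_simps)
    qed
  qed
qed

lemma GDERIV_in_frechet_subdiff:
  fixes s :: "'a::euclidean_space \<Rightarrow> real"
  assumes "GDERIV s x :> d"
  shows "d \<in> frechet_subdiff (\<lambda>y. ereal (s y)) x"
  unfolding frechet_subdiff_iff[where F = "\<lambda>y. ereal (s y)", OF refl]
proof (intro allI impI)
  fix e :: real assume e: "0 < e"
  have "(s has_derivative (\<lambda>h. h \<bullet> d)) (at x within UNIV)"
    using assms by (simp add: gderiv_def)
  then obtain \<delta> where \<delta>: "0 < \<delta>"
    "\<And>y. norm (y - x) < \<delta> \<Longrightarrow> norm (s y - s x - (y - x) \<bullet> d) \<le> e * norm (y - x)"
    using e unfolding has_derivative_within_alt by blast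
  have "\<forall>\<^sub>F y in nhds x. dist y x < \<delta>"
    using \<delta>(1) by (auto simp: eventually_nhds_metric)
  then show "\<forall>\<^sub>F y in nhds x. ereal (s x + d \<bullet> (y - x) - e * norm (y - x)) \<le> ereal (s y)"
    by (rule eventually_mono) (use \<delta>(2) in \<open>force simp: dist_norm inner_commute\<close>)
qed

lemma frechet_subdiff_add_smooth:
  assumes "F x = ereal r" "v \<in> frechet_subdiff F x" "GDERIV s x :> d"
  shows "v + d \<in> frechet_subdiff (\<lambda>y. F y + ereal (s y)) x"
  using assms by (intro frechet_subdiff_add GDERIV_in_frechet_subdiff) auto

lemma frechet_subdiff_at_minimum:
  assumes "F x = ereal r" "\<And>y. F x \<le> F y"
  shows "0 \<in> frechet_subdiff F x"
  unfolding frechet_subdiff_iff[where F = F and x = x, OF assms(1)]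
proof (intro allI impI always_eventually)
  fix e :: real and y assume e: "0 < e"
  have "ereal (r + 0 \<bullet> (y - x) - e * norm (y - x)) \<le> ereal r"
    using e by simp
  also have "\<dots> \<le> F y"
    using assms by metis
  finally show "ereal (r + 0 \<bullet> (y - x) - e * norm (y - x)) \<le> F y" .
qed

text \<open>Projections do not increase norms, so the error term of \<open>F\<close> on one factor
  is dominated by the one on the product. With the next lemma this stacks the subgradients of
  \<open>f\<close> and \<open>g\<close>, and lifts subgradients of the objective to the merit
  function.\<close>

lemma frechet_subdiff_fst:
  assumes r: "F (fst p) = ereal r" and v: "v \<in> frechet_subdiff F (fst p)"
  shows "(v, 0) \<in> frechet_subdiff (\<lambda>q. F (fst q)) p"
  unfolding frechet_subdiff_iff[where F = "\<lambda>q. F (fst q)", OF r]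
proof (intro allI impI)
  fix e :: real assume e: "0 < e"
  then have "\<forall>\<^sub>F y in nhds (fst p). ereal (r + v \<bullet> (y - fst p) - e * norm (y - fst p)) \<le> F y"
    using v r by (simp add: frechet_subdiff_iff)
  then have "\<forall>\<^sub>F q in nhds p. ereal (r + v \<bullet> (fst q - fst p) - e * norm (fst q - fst p)) \<le> F (fst q)"
    by (rule eventually_compose_filterlim) (intro tendsto_fst filterlim_ident)
  then show "\<forall>\<^sub>F q in nhds p. ereal (r + (v, 0) \<bullet> (q - p) - e * norm (q - p)) \<le> F (fst q)"
  proof eventually_elim
    case (elim q)
    have "e * norm (fst q - fst p) \<le> e * norm (q - p)"
      using e norm_fst_le[of "fst q - fst p" "snd q - snd p"]
      by (intro mult_left_mono) (auto simp: minus_prod_def)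
    then have "ereal (r + (v, 0) \<bullet> (q - p) - e * norm (q - p))
        \<le> ereal (r + v \<bullet> (fst q - fst p) - e * norm (fst q - fst p))"
      by (simp add: inner_prod_def)
    with elim show ?case by (rule order_trans[rotated])
  qed
qed

lemma frechet_subdiff_snd:
  assumes r: "F (snd p) = ereal r" and v: "v \<in> frechet_subdiff F (snd p)"
  shows "(0, v) \<in> frechet_subdiff (\<lambda>q. F (snd q)) p"
  unfolding frechet_subdiff_iff[where F = "\<lambda>q. F (snd q)", OF r]
proof (intro allI impI)
  fix e :: real assume e: "0 < e"
  then have "\<forall>\<^sub>F y in nhds (snd p). ereal (r + v \<bullet> (y - snd p) - e * norm (y - snd p)) \<le> F y"
    using v r by (simp add: frechet_subdiff_iff)
  then have "\<forall>\<^sub>F q in nhds p. ereal (r + v \<bullet> (snd q - snd p) - e * norm (snd q - snd p)) \<le> F (snd q)"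
    by (rule eventually_compose_filterlim) (intro tendsto_snd filterlim_ident)
  then show "\<forall>\<^sub>F q in nhds p. ereal (r + (0, v) \<bullet> (q - p) - e * norm (q - p)) \<le> F (snd q)"
  proof eventually_elim
    case (elim q)
    have "e * norm (snd q - snd p) \<le> e * norm (q - p)"
      using e norm_snd_le[of "snd q - snd p" "fst q - fst p"]
      by (intro mult_left_mono) (auto simp: minus_prod_def)
    then have "ereal (r + (0, v) \<bullet> (q - p) - e * norm (q - p))
        \<le> ereal (r + v \<bullet> (snd q - snd p) - e * norm (snd q - snd p))"
      by (simp add: inner_prod_def)
    with elim show ?case by (rule order_trans[rotated])
  qed
qed

lemma frechet_subset_limiting_subdiff:
  assumes "v \<in> frechet_subdiff F x"
  shows "v \<in> limiting_subdiff F x"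
proof -
  have "x \<in> edom F"
    using assms by (simp add: frechet_subdiff_def)
  moreover have "(\<lambda>_. x) \<longlonglongrightarrow> x" "(\<lambda>n. F x) \<longlonglongrightarrow> F x" "\<forall>n::nat. v \<in> frechet_subdiff F x"
      "(\<lambda>_. v) \<longlonglongrightarrow> v"
    using assms by auto
  ultimately show ?thesis
    unfolding limiting_subdiff_def mem_Collect_eq
    by (intro conjI exI[of _ "\<lambda>_. x"] exI[of _ "\<lambda>_. v"])
qed

lemma lsc_le_liminf:
  assumes "lsc F" "X \<longlonglongrightarrow> p"
  shows "F p \<le> liminf (\<lambda>n. F (X n))"
  unfolding le_Liminf_iff
proof (intro allI impI)
  fix c assume c: "c < F p"
  then have "c < Liminf (at p) F"
    using assms(1) unfolding lsc_def by (meson less_le_trans)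
  then have "\<forall>\<^sub>F y in at p. c < F y"
    by (rule less_LiminfD)
  \<comment> \<open>\<open>lsc\<close> uses punctured neighbourhoods, but \<open>X\<close> may take
    the value \<open>p\<close>; there the bound is \<open>c < F p\<close>.\<close>
  then have "\<forall>\<^sub>F y in nhds p. c < F y"
    unfolding eventually_at_filter by (rule eventually_mono) (use c in auto)
  then show "\<forall>\<^sub>F n in sequentially. c < F (X n)"
    using assms(2) by (rule eventually_compose_filterlim)
qed

subsection \<open>Bregman proximal steps\<close>

lemma bregman_self [simp]: "bregman \<phi> u u = 0"
  by (simp add: bregman_def)

text \<open>Partial gradient and both inertial terms are linear in \<open>v\<close>, so they merge
  into one coefficient. Each subproblem thus becomes a Bregman proximal step with a single linear
  term \<open>q\<close>.\<close>

lemma is_arg_min_inertial_iff: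
  fixes F :: "'a::euclidean_space \<Rightarrow> ereal"
  shows "is_arg_min (\<lambda>v. F v + ereal (v \<bullet> p + bregman \<phi> v u + c1 * (v \<bullet> d1) + c2 * (v \<bullet> d2)))
      (\<lambda>_. True) u' \<longleftrightarrow>
    (\<forall>v. F u' + ereal (u' \<bullet> (p + c1 *\<^sub>R d1 + c2 *\<^sub>R d2) + bregman \<phi> u' u)
      \<le> F v + ereal (v \<bullet> (p + c1 *\<^sub>R d1 + c2 *\<^sub>R d2) + bregman \<phi> v u))"
  by (simp add: is_arg_min_linorder inner_add_right add_ac)

lemma bregman_step_finite:
  assumes min: "\<And>v. F u' + ereal (u' \<bullet> q + bregman \<phi> u' u) \<le> F v + ereal (v \<bullet> q + bregman \<phi> v u)"
    and "F u = ereal r" and "F u' \<noteq> -\<infinity>"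
  shows "\<exists>r'. F u' = ereal r'"
  using min[of u] assms(2,3) by (cases "F u'") auto

text \<open>Minimality is tested at \<open>v = u\<close>. Strong convexity gains
  \<open>\<theta> / 2\<close>, the descent lemma trades the linear term in \<open>grad h u\<close>
  for \<open>h u' - h u\<close> at cost \<open>C / 2\<close>, and Young's inequality splits the
  products with \<open>d1\<close> and \<open>d2\<close>.\<close>

lemma bregman_step_decrease:
  assumes min: "\<And>v. F u' + ereal (u' \<bullet> q + bregman \<phi> u' u) \<le> F v + ereal (v \<bullet> q + bregman \<phi> v u)"
    and r: "F u = ereal r" "F u' = ereal r'"
    and \<phi>: "\<And>x. \<phi> differentiable (at x)" "strongly_convex \<theta> \<phi>"
    and h: "\<And>x. h differentiable (at x)" "C-lipschitz_on UNIV (grad h)"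
    and q: "q = grad h u + c1 *\<^sub>R d1 + c2 *\<^sub>R d2"
    and c: "0 \<le> c1" "c1 \<le> \<alpha>1" "0 \<le> c2" "c2 \<le> \<alpha>2"
  shows "r' + h u' + (\<theta> - C) / 2 * (norm (u' - u))\<^sup>2
    \<le> r + h u + (\<alpha>1 + \<alpha>2) / 2 * (norm (u' - u))\<^sup>2 + \<alpha>1 / 2 * (norm d1)\<^sup>2 + \<alpha>2 / 2 * (norm d2)\<^sup>2"
proof -
  \<comment> \<open>Expand the square of the norm of \<open>e + d\<close>. Only afterwards is
    \<open>c\<close> enlarged to \<open>\<alpha>\<close>, when its factor is a nonnegative sum of
    squares.\<close>
  have young: "- (c * (e \<bullet> d)) \<le> \<alpha> / 2 * (norm e)\<^sup>2 + \<alpha> / 2 * (norm d)\<^sup>2"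
    if "0 \<le> c" "c \<le> \<alpha>" for c \<alpha> and d e :: 'a
  proof -
    have "- (e \<bullet> d) \<le> ((norm e)\<^sup>2 + (norm d)\<^sup>2) / 2"
    proof -
      have "0 \<le> (norm (e + d))\<^sup>2" by simp
      then show ?thesis
        unfolding power2_norm_eq_inner by (simp add: inner_commute algebra_simps)
    qed
    then have "c * - (e \<bullet> d) \<le> c * (((norm e)\<^sup>2 + (norm d)\<^sup>2) / 2)"
      using that by (intro mult_left_mono)
    also have "\<dots> \<le> \<alpha> * (((norm e)\<^sup>2 + (norm d)\<^sup>2) / 2)"
      using that by (intro mult_right_mono) auto
    finally show ?thesis by (simp add: algebra_simps)
  qed
  have "r' + u' \<bullet> q + bregman \<phi> u' u \<le> r + u \<bullet> q"
    using min[of u] r by (simp add: add.assoc)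
  then have "r' + (u' - u) \<bullet> q + \<theta> / 2 * (norm (u' - u))\<^sup>2 \<le> r"
    using bregman_lower_bound[OF \<phi>, of u' u] by (simp add: inner_diff_left)
  moreover have "(u' - u) \<bullet> q = grad h u \<bullet> (u' - u) + c1 * ((u' - u) \<bullet> d1) + c2 * ((u' - u) \<bullet> d2)"
    by (simp add: q inner_add_right inner_commute)
  ultimately show ?thesis
    using descent_lemma[OF h, of u' u] young[OF c(1,2), of "u' - u" d1]
      young[OF c(3,4), of "u' - u" d2]
    by (simp add: diff_divide_distrib add_divide_distrib left_diff_distrib distrib_right)
qed

text \<open>Fermat's rule puts 0 into the subdifferential of \<open>F + s\<close>. Since
  \<open>s\<close> is smooth and finite everywhere, adding \<open>- s\<close> recovers
  \<open>F\<close> and subtracts the gradient of \<open>s\<close>.\<close>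

lemma bregman_step_subgradient:
  assumes min: "\<And>v. F u' + ereal (u' \<bullet> q + bregman \<phi> u' u) \<le> F v + ereal (v \<bullet> q + bregman \<phi> v u)"
    and r: "F u' = ereal r'" and \<phi>: "\<phi> differentiable (at u')"
  shows "- (q + (grad \<phi> u' - grad \<phi> u)) \<in> frechet_subdiff F u'"
proof -
  define s where "s v = v \<bullet> q + bregman \<phi> v u" for v
  have s: "GDERIV s u' :> q + (grad \<phi> u' - grad \<phi> u)"
  proof -
    have "GDERIV (\<lambda>v. v \<bullet> q) u' :> q"
      unfolding gderiv_def by (auto intro!: derivative_eq_intros)
    from GDERIV_add[OF this GDERIV_bregman[OF \<phi>, of u]] show ?thesis
      unfolding s_def[abs_def] .
  qed
  have fin: "F u' + ereal (s u') = ereal (r' + s u')"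
    by (simp add: r)
  have "0 \<in> frechet_subdiff (\<lambda>v. F v + ereal (s v)) u'"
    by (rule frechet_subdiff_at_minimum[where F = "\<lambda>v. F v + ereal (s v)", OF fin])
      (simp add: s_def min)
  from frechet_subdiff_add_smooth[where F = "\<lambda>v. F v + ereal (s v)", OF fin this GDERIV_minus[OF s]]
  have "- (q + (grad \<phi> u' - grad \<phi> u)) \<in> frechet_subdiff (\<lambda>v. F v + ereal (s v) + ereal (- s v)) u'"
    by simp
  moreover have "F v + ereal (s v) + ereal (- s v) = F v" for v
    by (cases "F v") auto
  ultimately show ?thesis
    by simp
qed

text \<open>Testing minimality at the limit \<open>p\<close> bounds the limit superior of the values
  by \<open>F p\<close>, because the smooth terms \<open>e n\<close> tend to 0. Lower semicontinuity
  gives the matching bound for the limit inferior.\<close>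

lemma bregman_step_value_tendsto:
  fixes F :: "'a::euclidean_space \<Rightarrow> ereal"
  assumes min: "\<And>n v. F (u' n) + ereal (u' n \<bullet> q n + bregman \<phi> (u' n) (u n))
      \<le> F v + ereal (v \<bullet> q n + bregman \<phi> v (u n))"
    and "lsc F" and "F p \<noteq> -\<infinity>"
    and \<phi>: "\<And>x. \<phi> differentiable (at x)" "continuous_on UNIV (grad \<phi>)"
    and lim: "u' \<longlonglongrightarrow> p" "u \<longlonglongrightarrow> p" "q \<longlonglongrightarrow> l"
  shows "(\<lambda>n. F (u' n)) \<longlonglongrightarrow> F p"
proof -
  define e where "e n = (p - u' n) \<bullet> q n + bregman \<phi> p (u n) - bregman \<phi> (u' n) (u n)" for n
  have cont: "isCont \<phi> p" "isCont (grad \<phi>) p"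
    using \<phi> by (auto simp: differentiable_imp_continuous_within continuous_on_eq_continuous_at)
  have "(\<lambda>n. \<phi> (u n)) \<longlonglongrightarrow> \<phi> p" "(\<lambda>n. \<phi> (u' n)) \<longlonglongrightarrow> \<phi> p" "(\<lambda>n. grad \<phi> (u n)) \<longlonglongrightarrow> grad \<phi> p"
    using cont lim by (auto intro: isCont_tendsto_compose)
  then have "e \<longlonglongrightarrow> (p - p) \<bullet> l + (\<phi> p - \<phi> p - grad \<phi> p \<bullet> (p - p)) - (\<phi> p - \<phi> p - grad \<phi> p \<bullet> (p - p))"
    unfolding e_def bregman_def using lim by (intro tendsto_intros)
  then have "(\<lambda>n. ereal (e n)) \<longlonglongrightarrow> 0"
    by (simp add: zero_ereal_def)
  then have "(\<lambda>n. F p + ereal (e n)) \<longlonglongrightarrow> F p + 0"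
    by (intro tendsto_add_ereal_general) auto
  moreover have "F (u' n) \<le> F p + ereal (e n)" for n
    using min[of n p] by (cases "F (u' n)"; cases "F p") (auto simp: e_def inner_diff_left)
  ultimately have "limsup (\<lambda>n. F (u' n)) \<le> F p"
    using Limsup_mono[of "\<lambda>n. F (u' n)" "\<lambda>n. F p + ereal (e n)" sequentially]
      lim_imp_Limsup[of sequentially "\<lambda>n. F p + ereal (e n)" "F p"] by simp
  moreover have "F p \<le> liminf (\<lambda>n. F (u' n))"
    using lsc_le_liminf assms(2) lim(1) .
  moreover have "liminf (\<lambda>n. F (u' n)) \<le> limsup (\<lambda>n. F (u' n))"
    by (simp add: Liminf_le_Limsup)
  ultimately show ?thesis
    by (intro tendsto_iff_Liminf_eq_Limsup[THEN iffD2]) auto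
qed

subsection \<open>Finite length from the Kurdyka--Lojasiewicz inequality\<close>

lemma dist_Pair_le: "dist (u, v) (u', v') \<le> dist u u' + dist v v'"
  unfolding dist_Pair_Pair by (simp add: sqrt_sum_squares_le_sum)

lemma prev_step_nonneg: "0 \<le> prev_step z k"
  by (simp add: prev_step_def)

text \<open>The potential \<open>3 * D k + 2 * D (k - 1) + D (k - 2) + h k\<close> with \<open>D = prev_step z\<close> drops by at
  least \<open>D (k + 1)\<close> in each step in which the iterates are close to \<open>p\<close>; as it starts below
  \<open>\<epsilon> / 2\<close>, they remain close to \<open>p\<close>.\<close>

lemma summable_prev_step_local:
  fixes z :: "nat \<Rightarrow> 'a::real_normed_vector" and h :: "nat \<Rightarrow> real"
  assumes N: "2 \<le> N"
    and rec: "\<And>k. N \<le> k \<Longrightarrow> dist (z k) p < \<epsilon> \<Longrightarrow> dist (z (k - 1)) p < \<epsilon> \<Longrightarrow> dist (z (k - 2)) p < \<epsilon> \<Longrightarrow>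
      4 * prev_step z (Suc k) \<le> prev_step z k + prev_step z (k - 1) + prev_step z (k - 2) + h k - h (Suc k)"
    and h: "\<And>k. N \<le> k \<Longrightarrow> 0 \<le> h k"
    and near: "dist (z N) p < \<epsilon> / 2" "dist (z (N - 1)) p < \<epsilon>" "dist (z (N - 2)) p < \<epsilon>"
    and small: "3 * prev_step z N + 2 * prev_step z (N - 1) + prev_step z (N - 2) + h N < \<epsilon> / 2"
  shows "summable (prev_step z)"
proof -
  let ?D = "prev_step z"
  define P where "P k = 3 * ?D k + 2 * ?D (k - 1) + ?D (k - 2) + h k" for k
  have P_ge: "0 \<le> P k" if "N \<le> k" for k
    using h[OF that] prev_step_nonneg[of z k] prev_step_nonneg[of z "k - 1"]
      prev_step_nonneg[of z "k - 2"] by (simp add: P_def)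
  have dist_sum: "dist (z (N + n)) (z N) \<le> (\<Sum>i<n. ?D (Suc (N + i)))" for n
  proof (induction n)
    case (Suc n)
    have "dist (z (N + Suc n)) (z N) \<le> ?D (Suc (N + n)) + dist (z (N + n)) (z N)"
      unfolding prev_step_def by (metis add_Suc_right diff_Suc_1 dist_norm dist_triangle)
    with Suc show ?case by simp
  qed simp
  \<comment> \<open>The two claims support each other: closeness so far permits the next use of
    \<open>rec\<close>, and the telescoped sum keeps the next iterate close.\<close>
  have main: "(\<forall>k. N - 2 \<le> k \<and> k \<le> N + n \<longrightarrow> dist (z k) p < \<epsilon>) \<and>
      (\<Sum>i<n. ?D (Suc (N + i))) + P (N + n) \<le> P N" for n
  proof (induction n)
    case 0
    have "0 < \<epsilon>"
      using near(2) zero_le_dist[of "z (N - 1)" p] by linarith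
    have "dist (z k) p < \<epsilon>" if k: "N - 2 \<le> k" "k \<le> N" for k
    proof -
      consider "k = N" | "k = N - 1" | "k = N - 2" using k by arith
      then show ?thesis using near \<open>0 < \<epsilon>\<close> by cases auto
    qed
    then show ?case by simp
  next
    case (Suc n)
    have "4 * ?D (Suc (N + n)) \<le> ?D (N + n) + ?D (N + n - 1) + ?D (N + n - 2) + h (N + n) - h (Suc (N + n))"
      using Suc.IH N by (intro rec) auto
    moreover have "Suc (N + n) - 2 = N + n - 1"
      by simp
    \<comment> \<open>With the weights 3, 2, 1, the drop \<open>P k - P (Suc k)\<close> equals the
      right-hand side of \<open>rec\<close> minus three times the new step, and \<open>rec\<close>
      makes that side at least four times the new step.\<close>
    ultimately have "?D (Suc (N + n)) + P (Suc (N + n)) \<le> P (N + n)"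
      unfolding P_def by (simp only: diff_Suc_1)
    with Suc.IH have sum: "(\<Sum>i<Suc n. ?D (Suc (N + i))) + P (N + Suc n) \<le> P N"
      by simp
    have "dist (z (N + Suc n)) p \<le> dist (z (N + Suc n)) (z N) + dist (z N) p"
      by (rule dist_triangle)
    also have "\<dots> < \<epsilon>"
      using dist_sum[of "Suc n"] sum near(1) small P_ge[of "N + Suc n"] by (simp add: P_def)
    finally have "dist (z (N + Suc n)) p < \<epsilon>" .
    with Suc.IH sum show ?case
      by (metis add_Suc_right le_Suc_eq)
  qed
  have "summable (\<lambda>i. ?D (Suc (N + i)))"
  proof (rule summableI_nonneg_bounded[where x = "P N"])
    show "(\<Sum>i<n. ?D (Suc (N + i))) \<le> P N" for n
      using main[of n] P_ge[of "N + n"] by linarith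
  qed (rule prev_step_nonneg)
  then have "summable (\<lambda>i. ?D (i + Suc N))"
    by (simp add: add.commute)
  then show ?thesis
    by (rule summable_iff_shift[THEN iffD1])
qed

text \<open>A decreasing sequence bounded below converges, so its consecutive differences vanish;
  they dominate \<open>a\<close> times the squared steps.\<close>

lemma prev_step_tendsto_zero:
  fixes h :: "nat \<Rightarrow> real"
  assumes dec: "\<And>k. h (Suc k) + a * (prev_step z (Suc k))\<^sup>2 \<le> h k" and "0 < a"
    and bdd: "\<And>k. B \<le> h k"
  shows "prev_step z \<longlonglongrightarrow> 0"
proof -
  have "h (Suc k) \<le> h k" for k
  proof -
    have "0 \<le> a * (prev_step z (Suc k))\<^sup>2"
      using \<open>0 < a\<close> by simp
    then show ?thesis
      using dec[of k] by linarith
  qed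
  then have "decseq h"
    by (rule decseq_SucI)
  moreover have "\<forall>k. B \<le> h k"
    using bdd by simp
  ultimately obtain l where l: "h \<longlonglongrightarrow> l"
    by (rule decseq_convergent)
  have "(\<lambda>k. (h k - h (Suc k)) / a) \<longlonglongrightarrow> (l - l) / a"
    using \<open>0 < a\<close> by (intro tendsto_intros l LIMSEQ_Suc[OF l]) auto
  from tendsto_real_sqrt[OF this] have "(\<lambda>k. sqrt ((h k - h (Suc k)) / a)) \<longlonglongrightarrow> 0"
    by (simp del: real_sqrt_divide)
  moreover have "prev_step z (Suc k) \<le> sqrt ((h k - h (Suc k)) / a)" for k
    using dec[of k] \<open>0 < a\<close> by (intro real_le_rsqrt) (simp add: field_simps)
  then have "\<forall>\<^sub>F k in sequentially. norm (prev_step z (Suc k)) \<le> sqrt ((h k - h (Suc k)) / a)"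
    by (simp add: prev_step_nonneg)
  ultimately have "(\<lambda>k. prev_step z (Suc k)) \<longlonglongrightarrow> 0"
    by (rule Lim_null_comparison[rotated])
  then show ?thesis
    by (rule LIMSEQ_imp_Suc)
qed

lemma concave_below_tangent:
  fixes \<phi> :: "real \<Rightarrow> real"
  assumes "concave_on A \<phi>" "connected A" "c \<in> interior A" "x \<in> A"
    "(\<phi> has_real_derivative d) (at c)"
  shows "\<phi> x - \<phi> c \<le> d * (x - c)"
proof -
  have "((\<lambda>t. - \<phi> t) has_real_derivative - d) (at c within A)"
    using DERIV_minus[OF assms(5)] by (rule has_field_derivative_at_within)
  from convex_on_imp_above_tangent[OF assms(1)[unfolded concave_on_def] assms(2-4) this]
  show ?thesis by simp
qed

text \<open>The KL inequality and the subgradient bound make \<open>\<phi>'\<close> at the current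
  gap at least the reciprocal of \<open>b * S\<close>. The tangent inequality converts the decrease
  of \<open>h\<close> into a decrease of \<open>\<phi>\<close>, and a square root yields the
  recursion of \<open>summable_prev_step_local\<close>; the subsequence \<open>r\<close> supplies a
  starting index.\<close>

lemma KL_finite_length:
  fixes z :: "nat \<Rightarrow> 'a::euclidean_space" and H :: "'a \<times> 'a \<times> 'a \<Rightarrow> ereal"
  assumes KL: "KL_property H (p, p, p)"
    and fin: "\<And>k. H (lifted_seq z k) = ereal (h k)" "H (p, p, p) = ereal hs"
    and dec: "\<And>k. h (Suc k) + a * (prev_step z (Suc k))\<^sup>2 \<le> h k"
    and ab: "0 < a" "0 < b"
    and sub: "\<And>k. \<exists>w \<in> limiting_subdiff H (lifted_seq z (Suc k)).
      norm w \<le> b * (prev_step z (Suc k) + prev_step z k + prev_step z (k - 1))"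
    and r: "strict_mono r" "(\<lambda>j. lifted_seq z (r j)) \<longlonglongrightarrow> (p, p, p)" "(\<lambda>j. h (r j)) \<longlonglongrightarrow> hs"
  shows "summable (prev_step z)" and "z \<longlonglongrightarrow> p"
proof -
  let ?D = "prev_step z"
  obtain \<eta> :: ereal and U \<phi> \<phi>' where \<eta>: "0 < \<eta>" and U: "open U" "(p, p, p) \<in> U"
    and cont: "continuous_on {t. 0 \<le> t \<and> ereal t < \<eta>} \<phi>"
    and conc: "concave_on {t. 0 \<le> t \<and> ereal t < \<eta>} \<phi>"
    and nonneg: "\<And>t. 0 \<le> t \<Longrightarrow> ereal t < \<eta> \<Longrightarrow> 0 \<le> \<phi> t"
    and zero: "\<phi> 0 = 0"
    and deriv: "\<And>t. 0 < t \<Longrightarrow> ereal t < \<eta> \<Longrightarrow> (\<phi> has_real_derivative \<phi>' t) (at t)"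
    and pos: "\<And>t. 0 < t \<Longrightarrow> ereal t < \<eta> \<Longrightarrow> 0 < \<phi>' t"
    and ineq: "\<And>x. x \<in> U \<Longrightarrow> H (p, p, p) < H x \<Longrightarrow> H x < H (p, p, p) + \<eta> \<Longrightarrow>
      1 \<le> ereal (\<phi>' (real_of_ereal (H x - H (p, p, p)))) * edist 0 (limiting_subdiff H x)"
    using KL unfolding KL_property_def by blast
  define I where "I = {t. 0 \<le> t \<and> ereal t < \<eta>}"
  have h_Suc: "h (Suc k) \<le> h k" for k
  proof -
    have "0 \<le> a * (?D (Suc k))\<^sup>2"
      using ab by simp
    then show ?thesis
      using dec[of k] by linarith
  qed
  then have "decseq h"
    by (rule decseq_SucI)
  have ge: "hs \<le> h k" for k
  proof (rule LIMSEQ_le_const2[OF r(3)])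
    show "\<exists>N. \<forall>n\<ge>N. h (r n) \<le> h k"
      by (intro exI[of _ k] allI impI decseqD[OF \<open>decseq h\<close>] order_trans[OF _ seq_suble[OF r(1)]])
  qed
  have D0: "?D \<longlonglongrightarrow> 0"
    using dec ab(1) ge by (rule prev_step_tendsto_zero)
  obtain e where e: "0 < e" "ball (p, p, p) e \<subseteq> U"
    using U open_contains_ball by blast
  \<comment> \<open>The distance in the triple product is at most the sum of three component
    distances.\<close>
  define \<epsilon> where "\<epsilon> = e / 3"
  have in_U: "lifted_seq z k \<in> U"
    if "dist (z k) p < \<epsilon>" "dist (z (k - 1)) p < \<epsilon>" "dist (z (k - 2)) p < \<epsilon>" for k
  proof -
    have "dist (lifted_seq z k) (p, p, p) \<le> dist (z k) p + (dist (z (k - 1)) p + dist (z (k - 2)) p)"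
      unfolding lifted_seq_def by (intro order_trans[OF dist_Pair_le] add_left_mono dist_Pair_le)
    with that e show ?thesis
      by (auto simp: \<epsilon>_def dist_commute)
  qed
  define g where "g k = 4 * (b / a) * \<phi> (h k - hs)" for k
  have rec: "4 * ?D (Suc k) \<le> ?D k + ?D (k - 1) + ?D (k - 2) + g k - g (Suc k)"
    if k: "1 \<le> k" "ereal (h k - hs) < \<eta>" "lifted_seq z k \<in> U" for k
  proof (cases "h k = hs")
    \<comment> \<open>The KL inequality is silent when the gap is 0, but then \<open>h\<close> can
      decrease no further and the next step vanishes.\<close>
    case True
    then have "h (Suc k) = hs"
      using ge[of "Suc k"] h_Suc[of k] by simp
    then have "a * (?D (Suc k))\<^sup>2 \<le> 0"
      using dec[of k] True by simp
    then have "?D (Suc k) = 0"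
      using ab by (simp add: mult_le_0_iff)
    with True \<open>h (Suc k) = hs\<close> show ?thesis
      by (simp add: g_def prev_step_nonneg)
  next
    case False
    define t t' S where "t = h k - hs" and "t' = h (Suc k) - hs" and "S = ?D k + ?D (k - 1) + ?D (k - 2)"
    have t: "0 < t" "ereal t < \<eta>" and t': "0 \<le> t'" "t' \<le> t"
      using False ge[of k] ge[of "Suc k"] k h_Suc[of k] by (auto simp: t_def t'_def)
    have S: "0 \<le> S"
      by (simp add: S_def prev_step_nonneg)
    \<comment> \<open>\<open>sub\<close> speaks about successor indices, hence the instance
      \<open>k - 1\<close> and the requirement \<open>1 \<le> k\<close>.\<close>
    obtain w where w: "w \<in> limiting_subdiff H (lifted_seq z k)" "norm w \<le> b * S"
      using sub[of "k - 1"] k(1) by (auto simp: S_def numeral_2_eq_2)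
    have "ereal (h k) < ereal hs + \<eta>"
      using t(2) by (cases \<eta>) (auto simp: t_def)
    then have "1 \<le> ereal (\<phi>' t) * edist 0 (limiting_subdiff H (lifted_seq z k))"
      using ineq[OF k(3)] t(1) by (simp add: fin t_def)
    also have "\<dots> \<le> ereal (\<phi>' t) * ereal (norm w)"
    proof (rule ereal_mult_left_mono)
      show "edist 0 (limiting_subdiff H (lifted_seq z k)) \<le> ereal (norm w)"
        unfolding edist_def using INF_lower[OF w(1), of "\<lambda>v. ereal (dist 0 v)"] by simp
    qed (use pos[OF t] in simp)
    finally have "1 \<le> \<phi>' t * norm w"
      by (simp add: one_ereal_def)
    also have "\<dots> \<le> \<phi>' t * (b * S)"
      using pos[OF t] w(2) by (intro mult_left_mono) auto
    finally have one: "1 \<le> \<phi>' t * (b * S)" .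
    \<comment> \<open>The tangent is taken at the interior point \<open>t\<close>, where
      \<open>\<phi>\<close> is differentiable; \<open>t'\<close> may be the endpoint 0.\<close>
    have tangent: "\<phi> t' - \<phi> t \<le> \<phi>' t * (t' - t)"
    proof (rule concave_below_tangent[OF conc])
      show "connected {t. 0 \<le> t \<and> ereal t < \<eta>}"
        by (rule convex_connected, rule is_interval_convex_1[THEN iffD1])
          (auto simp: is_interval_1 intro: le_less_trans[of "ereal _" "ereal _" \<eta>])
      have o: "open {t. 0 < t \<and> ereal t < \<eta>}"
        by (intro open_Collect_conj open_Collect_less continuous_intros)
      show "t \<in> interior {t. 0 \<le> t \<and> ereal t < \<eta>}"
        by (rule interiorI[OF o]) (use t in auto)
      show "t' \<in> {t. 0 \<le> t \<and> ereal t < \<eta>}"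
        using t t' by (auto intro: le_less_trans[of _ "ereal t"])
    qed (rule deriv[OF t])
    have "\<phi>' t * (a * (?D (Suc k))\<^sup>2) \<le> \<phi>' t * (t - t')"
      using dec[of k] pos[OF t] by (intro mult_left_mono) (auto simp: t_def t'_def)
    then have *: "\<phi>' t * (a * (?D (Suc k))\<^sup>2) \<le> \<phi> t - \<phi> t'"
      using tangent by (simp add: algebra_simps)
    have "a * (?D (Suc k))\<^sup>2 \<le> \<phi>' t * (b * S) * (a * (?D (Suc k))\<^sup>2)"
      using mult_right_mono[OF one, of "a * (?D (Suc k))\<^sup>2"] ab by simp
    also have "\<dots> = b * S * (\<phi>' t * (a * (?D (Suc k))\<^sup>2))"
      by (simp add: mult_ac)
    also have "\<dots> \<le> b * S * (\<phi> t - \<phi> t')"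
      using * S ab by (intro mult_left_mono) auto
    finally have le: "(?D (Suc k))\<^sup>2 \<le> S * ((b / a) * (\<phi> t - \<phi> t'))"
      using ab by (simp add: field_simps)
    have "\<phi> t' \<le> \<phi> t"
    proof -
      have "0 \<le> \<phi>' t * (a * (?D (Suc k))\<^sup>2)"
        using pos[OF t] ab by (intro mult_nonneg_nonneg) auto
      with * show ?thesis by linarith
    qed
    \<comment> \<open>This equals \<open>g k - g (Suc k)\<close>. The factor 4 turns the bound
      \<open>le\<close> into \<open>4 * (S * d)\<close> for the square of four steps, and that is at
      most the square of \<open>S + d\<close>.\<close>
    define d where "d = 4 * ((b / a) * (\<phi> t - \<phi> t'))"
    have "(4 * ?D (Suc k))\<^sup>2 \<le> (S + d)\<^sup>2"
    proof -
      have "(4 * ?D (Suc k))\<^sup>2 \<le> 4 * (S * d)"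
        using le by (simp add: d_def power_mult_distrib)
      also have "\<dots> \<le> (S + d)\<^sup>2"
        using zero_le_power2[of "S - d"] by (simp add: power2_eq_square algebra_simps)
      finally show ?thesis .
    qed
    moreover have "0 \<le> d"
      unfolding d_def using \<open>\<phi> t' \<le> \<phi> t\<close> ab by simp
    then have "0 \<le> S + d"
      using S by simp
    ultimately have "4 * ?D (Suc k) \<le> S + d"
      by (rule power2_le_imp_le)
    also have "S + d = ?D k + ?D (k - 1) + ?D (k - 2) + g k - g (Suc k)"
      by (simp add: S_def d_def g_def t_def t'_def algebra_simps)
    finally show ?thesis .
  qed
  have lim: "(\<lambda>j. z (r j)) \<longlonglongrightarrow> p" "(\<lambda>j. z (r j - 1)) \<longlonglongrightarrow> p" "(\<lambda>j. z (r j - 2)) \<longlonglongrightarrow> p"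
    using tendsto_fst[OF r(2)] tendsto_fst[OF tendsto_snd[OF r(2)]]
      tendsto_snd[OF tendsto_snd[OF r(2)]] by (simp_all add: lifted_seq_def)
  have r_top: "filterlim r at_top sequentially"
    using r(1) by (rule filterlim_subseq)
  have gap: "(\<lambda>j. h (r j) - hs) \<longlonglongrightarrow> 0"
    using tendsto_diff[OF r(3) tendsto_const, of hs] by simp
  have gap_less: "\<forall>\<^sub>F j in sequentially. ereal (h (r j) - hs) < \<eta>"
  proof -
    have "(\<lambda>j. ereal (h (r j) - hs)) \<longlonglongrightarrow> 0"
      using gap by (simp add: zero_ereal_def)
    then show ?thesis
      using \<eta> by (rule order_tendstoD(2))
  qed
  \<comment> \<open>Continuity of \<open>\<phi>\<close> at the endpoint 0, within its domain, makes
    the last part of the starting potential small.\<close>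
  have "(\<lambda>j. \<phi> (h (r j) - hs)) \<longlonglongrightarrow> \<phi> 0"
    using gap by (rule continuous_on_tendsto_compose[OF cont])
      (use \<eta> gap_less ge in \<open>auto simp: zero_ereal_def elim: eventually_mono\<close>)
  then have "(\<lambda>j. g (r j)) \<longlonglongrightarrow> 4 * (b / a) * 0"
    unfolding g_def zero by (rule tendsto_mult_left)
  moreover have "(\<lambda>j. ?D (r j)) \<longlonglongrightarrow> 0" "(\<lambda>j. ?D (r j - 1)) \<longlonglongrightarrow> 0" "(\<lambda>j. ?D (r j - 2)) \<longlonglongrightarrow> 0"
    by (rule filterlim_compose[OF D0] filterlim_compose[OF filterlim_minus_const_nat_at_top] r_top)+
  ultimately have "(\<lambda>j. 3 * ?D (r j) + 2 * ?D (r j - 1) + ?D (r j - 2) + g (r j))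
      \<longlonglongrightarrow> 3 * 0 + 2 * 0 + 0 + 4 * (b / a) * 0"
    by (intro tendsto_intros)
  then have "\<forall>\<^sub>F j in sequentially. 3 * ?D (r j) + 2 * ?D (r j - 1) + ?D (r j - 2) + g (r j) < \<epsilon> / 2"
    by (rule order_tendstoD(2)) (use e in \<open>simp add: \<epsilon>_def\<close>)
  moreover have "\<forall>\<^sub>F j in sequentially. dist (z (r j)) p < \<epsilon> / 2"
      "\<forall>\<^sub>F j in sequentially. dist (z (r j - 1)) p < \<epsilon>" "\<forall>\<^sub>F j in sequentially. dist (z (r j - 2)) p < \<epsilon>"
    using e by (intro lim[THEN tendstoD]; simp add: \<epsilon>_def)+
  moreover have "\<forall>\<^sub>F j in sequentially. 2 \<le> r j"
    using r_top by (simp add: filterlim_at_top)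
  \<comment> \<open>Any late \<open>r j\<close> is a valid starting index for the local lemma. The
    conclusion is independent of \<open>j\<close>, so holding eventually means holding.\<close>
  ultimately have "\<forall>\<^sub>F j in sequentially. summable ?D"
    using gap_less
  proof eventually_elim
    case (elim j)
    have gap_k: "0 \<le> h k - hs \<and> ereal (h k - hs) < \<eta>" if "r j \<le> k" for k
    proof -
      have "ereal (h k - hs) \<le> ereal (h (r j) - hs)"
        using \<open>decseq h\<close> that by (simp add: decseqD)
      also have "\<dots> < \<eta>"
        by fact
      finally show ?thesis
        using ge[of k] by simp
    qed
    show ?case
    proof (rule summable_prev_step_local[where N = "r j" and p = p and \<epsilon> = \<epsilon> and h = g])
      fix k assume "r j \<le> k" "dist (z k) p < \<epsilon>" "dist (z (k - 1)) p < \<epsilon>" "dist (z (k - 2)) p < \<epsilon>"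
      then show "4 * ?D (Suc k) \<le> ?D k + ?D (k - 1) + ?D (k - 2) + g k - g (Suc k)"
        using gap_k elim by (intro rec in_U) auto
    next
      fix k assume "r j \<le> k"
      then show "0 \<le> g k"
        using gap_k nonneg ab by (auto simp: g_def)
    qed (use elim in auto)
  qed
  then show sm: "summable ?D"
    by simp
  have "summable (\<lambda>k. norm (z (Suc k) - z k))"
    using summable_Suc_iff[THEN iffD2, OF sm] by (simp add: prev_step_def)
  then have "summable (\<lambda>k. z (Suc k) - z k)"
    by (rule summable_norm_cancel)
  \<comment> \<open>The telescoping series shows that the whole sequence converges; the subsequence
    \<open>r\<close> then identifies the limit as \<open>p\<close>.\<close>
  then obtain q where "(\<lambda>n. \<Sum>k<n. z (Suc k) - z k) \<longlonglongrightarrow> q"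
    by (auto dest: summable_LIMSEQ)
  then have "(\<lambda>n. z n - z 0 + z 0) \<longlonglongrightarrow> q + z 0"
    unfolding sum_lessThan_telescope by (intro tendsto_intros)
  then have q: "z \<longlonglongrightarrow> q + z 0"
    by simp
  then have "(\<lambda>j. z (r j)) \<longlonglongrightarrow> q + z 0"
    using r_top by (rule filterlim_compose)
  with lim(1) q show "z \<longlonglongrightarrow> p"
    using LIMSEQ_unique by blast
qed

subsection \<open>The alternating scheme\<close>

lemma scaleR_bounded_tendsto_0:
  fixes d :: "nat \<Rightarrow> 'a::real_normed_vector"
  assumes "\<And>j. 0 \<le> c j" "\<And>j. c j \<le> (C :: real)" "d \<longlonglongrightarrow> 0"
  shows "(\<lambda>j. c j *\<^sub>R d j) \<longlonglongrightarrow> 0"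
proof (rule Lim_null_comparison)
  show "\<forall>\<^sub>F j in sequentially. norm (c j *\<^sub>R d j) \<le> C * norm (d j)"
    using assms(1,2) by (intro always_eventually allI) (simp add: mult_right_mono)
  show "(\<lambda>j. C * norm (d j)) \<longlonglongrightarrow> 0"
    using tendsto_mult_right_zero[OF tendsto_norm_zero[OF assms(3)]] .
qed

locale inertial_bpalm =
  fixes f :: "'a::euclidean_space \<Rightarrow> ereal" and g :: "'b::euclidean_space \<Rightarrow> ereal"
    and Q :: "'a \<times> 'b \<Rightarrow> real"
    and \<phi>1 :: "'a \<Rightarrow> real" and \<phi>2 :: "'b \<Rightarrow> real"
    and \<theta>1 \<theta>2 L\<phi>1 L\<phi>2 \<alpha>1 \<alpha>2 L1p L2p \<rho> :: real
    and \<alpha>1s \<alpha>2s \<beta>1s \<beta>2s :: "nat \<Rightarrow> real"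
    and L1 :: "'b \<Rightarrow> real" and L2 :: "'a \<Rightarrow> real"
    and x :: "nat \<Rightarrow> 'a" and y :: "nat \<Rightarrow> 'b"
  assumes f: "proper_fun f" "lsc f"
    and g: "proper_fun g" "lsc g"
    and Q: "C1 Q" "lipschitz_on_bounded (grad Q)"
    and inf_L: "(INF u. objective f Q g u) > -\<infinity>"
    and \<phi>1: "\<And>u. \<phi>1 differentiable (at u)" "strongly_convex \<theta>1 \<phi>1"
      "L\<phi>1-lipschitz_on UNIV (grad \<phi>1)"
    and \<phi>2: "\<And>u. \<phi>2 differentiable (at u)" "strongly_convex \<theta>2 \<phi>2"
      "L\<phi>2-lipschitz_on UNIV (grad \<phi>2)"
    and \<alpha>1s: "\<And>k. 0 \<le> \<alpha>1s k" "\<And>k. \<alpha>1s k \<le> \<alpha>1"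
    and \<alpha>2s: "\<And>k. 0 \<le> \<alpha>2s k" "\<And>k. \<alpha>2s k \<le> \<alpha>2"
    and \<beta>1s: "\<And>k. 0 \<le> \<beta>1s k" "\<And>k. \<beta>1s k \<le> \<alpha>1"
    and \<beta>2s: "\<And>k. 0 \<le> \<beta>2s k" "\<And>k. \<beta>2s k \<le> \<alpha>2"
    and scheme: "inertial_scheme f Q g \<phi>1 \<phi>2 \<alpha>1s \<alpha>2s \<beta>1s \<beta>2s x y"
    and lip_x: "\<And>v. (L1 v)-lipschitz_on UNIV (\<lambda>u. grad_fst Q u v)"
    and lip_y: "\<And>u. (L2 u)-lipschitz_on UNIV (\<lambda>v. grad_snd Q u v)"
    and Lp: "\<And>k. L1 (y k) \<le> L1p" "\<And>k. L2 (x k) \<le> L2p"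
    and \<rho>: "\<rho> \<le> \<theta>1 - L1p" "\<rho> \<le> \<theta>2 - L2p" "2 * (\<alpha>1 + \<alpha>2) < \<rho>"
    and coercive: "coercive (objective f Q g)"
begin

definition z :: "nat \<Rightarrow> 'a \<times> 'b" where
  "z k = (x k, y k)"

abbreviation L :: "'a \<times> 'b \<Rightarrow> ereal" where
  "L \<equiv> objective f Q g"

abbreviation H :: "('a \<times> 'b) \<times> ('a \<times> 'b) \<times> ('a \<times> 'b) \<Rightarrow> ereal" where
  "H \<equiv> merit \<alpha>1 \<alpha>2 L"

abbreviation D :: "nat \<Rightarrow> real" where
  "D \<equiv> prev_step z"

text \<open>The merged linear coefficient of the \<open>x\<close> subproblem. Its counterpart
  \<open>qy\<close> takes the gradient at the fresh \<open>x (Suc k)\<close>, since the blocks are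
  updated in turn.\<close>

definition qx :: "nat \<Rightarrow> 'a" where
  "qx k = grad_fst Q (x k) (y k) + \<alpha>1s k *\<^sub>R (x (k - 1) - x k) + \<alpha>2s k *\<^sub>R (x (k - 2) - x (k - 1))"

definition qy :: "nat \<Rightarrow> 'b" where
  "qy k = grad_snd Q (x (Suc k)) (y k)
    + \<beta>1s k *\<^sub>R (y (k - 1) - y k) + \<beta>2s k *\<^sub>R (y (k - 2) - y (k - 1))"

lemma \<alpha>_nonneg: "0 \<le> \<alpha>1" "0 \<le> \<alpha>2"
  using \<alpha>1s[of 0] \<alpha>2s[of 0] by linarith+

lemma Q_differentiable: "Q differentiable (at p)"
  using Q(1) unfolding C1_def by blast

lemma grad_Q_eq: "grad Q (u, v) = (grad_fst Q u v, grad_snd Q u v)"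
  by (simp add: grad_fst_eq grad_snd_eq Q_differentiable)

lemma Q_partial_differentiable: "(\<lambda>u. Q (u, v)) differentiable (at w)" "(\<lambda>v. Q (u, v)) differentiable (at w')"
  using GDERIV_partial_fst[OF GDERIV_grad[OF Q_differentiable]]
    GDERIV_partial_snd[OF GDERIV_grad[OF Q_differentiable]]
  unfolding gderiv_def differentiable_def by blast+

lemma x_step: "f (x (Suc k)) + ereal (x (Suc k) \<bullet> qx k + bregman \<phi>1 (x (Suc k)) (x k))
    \<le> f v + ereal (v \<bullet> qx k + bregman \<phi>1 v (x k))"
  using scheme unfolding inertial_scheme_def is_arg_min_inertial_iff qx_def by simp

lemma y_step: "g (y (Suc k)) + ereal (y (Suc k) \<bullet> qy k + bregman \<phi>2 (y (Suc k)) (y k))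
    \<le> g v + ereal (v \<bullet> qy k + bregman \<phi>2 v (y k))"
  using scheme unfolding inertial_scheme_def is_arg_min_inertial_iff qy_def by simp

lemma not_MInf: "f u \<noteq> -\<infinity>" "g v \<noteq> -\<infinity>"
  using f g by (auto simp: proper_fun_def)

text \<open>Real values allow ordinary arithmetic; \<open>f_x\<close> and \<open>g_y\<close> show
  that the default of \<open>real_of_ereal\<close> at infinite arguments never occurs.\<close>

definition fx :: "nat \<Rightarrow> real" where "fx k = real_of_ereal (f (x k))"
definition gy :: "nat \<Rightarrow> real" where "gy k = real_of_ereal (g (y k))"

text \<open>The starting point lies in the domain, and each minimiser competes with the previous
  iterate, whose value is finite.\<close>

lemma f_x: "f (x k) = ereal (fx k)" and g_y: "g (y k) = ereal (gy k)"
proof -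
  have "(\<exists>r. f (x k) = ereal r) \<and> (\<exists>r. g (y k) = ereal r)"
  proof (induction k)
    case 0
    have "f (x 0) + ereal (Q (x 0, y 0)) + g (y 0) < \<infinity>"
      using scheme by (simp add: inertial_scheme_def edom_def objective_def)
    then show ?case
      using not_MInf(1)[of "x 0"] not_MInf(2)[of "y 0"] by (cases "f (x 0)"; cases "g (y 0)") auto
  next
    case (Suc k)
    then show ?case
      using bregman_step_finite[OF x_step] bregman_step_finite[OF y_step] not_MInf by blast
  qed
  then show "f (x k) = ereal (fx k)" "g (y k) = ereal (gy k)"
    by (auto simp: fx_def gy_def)
qed

definition l :: "nat \<Rightarrow> real" where "l k = fx k + Q (z k) + gy k"
definition h :: "nat \<Rightarrow> real" where
  "h k = l k + (\<alpha>1 + \<alpha>2) / 2 * (D k)\<^sup>2 + \<alpha>2 / 2 * (D (k - 1))\<^sup>2"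
text \<open>Of the loss \<open>\<alpha>1 + \<alpha>2\<close>, one half comes from Young's inequality
  and the other from the coupling term of the new step in \<open>h (Suc k)\<close>.\<close>

definition a :: real where "a = \<rho> / 2 - (\<alpha>1 + \<alpha>2)"

section \<open>Sufficient decrease and boundedness of the iterates\<close>

lemma L_z: "L (z k) = ereal (l k)"
  by (simp add: objective_def z_def l_def f_x g_y)

lemma H_lifted: "H (lifted_seq z k) = ereal (h k)"
  by (simp add: merit_def lifted_seq_def L_z h_def prev_step_def numeral_2_eq_2)

lemma a_pos: "0 < a"
  using \<rho>(3) by (simp add: a_def)

lemma D_sq: "(D k)\<^sup>2 = (norm (x k - x (k - 1)))\<^sup>2 + (norm (y k - y (k - 1)))\<^sup>2"
  by (simp add: prev_step_def z_def norm_Pair)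

text \<open>The \<open>x\<close> step with \<open>y k\<close> frozen and the \<open>y\<close> step
  with \<open>x (Suc k)\<close> frozen share the mixed value \<open>Q (x (Suc k), y k)\<close>,
  which cancels on addition. The rest regroups into \<open>h\<close>.\<close>

lemma decrease: "h (Suc k) + a * (D (Suc k))\<^sup>2 \<le> h k"
proof -
  define X Y where "X = (norm (x (Suc k) - x k))\<^sup>2" and "Y = (norm (y (Suc k) - y k))\<^sup>2"
  have "fx (Suc k) + Q (x (Suc k), y k) + (\<theta>1 - L1 (y k)) / 2 * X
    \<le> fx k + Q (x k, y k) + (\<alpha>1 + \<alpha>2) / 2 * X
      + \<alpha>1 / 2 * (norm (x (k - 1) - x k))\<^sup>2 + \<alpha>2 / 2 * (norm (x (k - 2) - x (k - 1)))\<^sup>2"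
    unfolding X_def
  proof (rule bregman_step_decrease[where h = "\<lambda>u. Q (u, y k)", OF x_step f_x f_x \<phi>1(1,2)
        Q_partial_differentiable(1) _ _ \<alpha>1s \<alpha>2s])
    show "(L1 (y k))-lipschitz_on UNIV (grad (\<lambda>u. Q (u, y k)))"
      using lip_x[of "y k"] by (simp add: grad_fst_def[abs_def])
  qed (simp add: qx_def grad_fst_def)
  moreover have "gy (Suc k) + Q (x (Suc k), y (Suc k)) + (\<theta>2 - L2 (x (Suc k))) / 2 * Y
    \<le> gy k + Q (x (Suc k), y k) + (\<alpha>1 + \<alpha>2) / 2 * Y
      + \<alpha>1 / 2 * (norm (y (k - 1) - y k))\<^sup>2 + \<alpha>2 / 2 * (norm (y (k - 2) - y (k - 1)))\<^sup>2"
    unfolding Y_def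
  proof (rule bregman_step_decrease[where h = "\<lambda>v. Q (x (Suc k), v)", OF y_step g_y g_y \<phi>2(1,2)
        Q_partial_differentiable(2) _ _ \<beta>1s \<beta>2s])
    show "(L2 (x (Suc k)))-lipschitz_on UNIV (grad (\<lambda>v. Q (x (Suc k), v)))"
      using lip_y[of "x (Suc k)"] by (simp add: grad_snd_def[abs_def])
  qed (simp add: qy_def grad_snd_def)
  moreover have "\<rho> / 2 * X \<le> (\<theta>1 - L1 (y k)) / 2 * X" "\<rho> / 2 * Y \<le> (\<theta>2 - L2 (x (Suc k))) / 2 * Y"
    using \<rho> Lp(1)[of k] Lp(2)[of "Suc k"] by (auto simp: X_def Y_def intro!: mult_right_mono)
  moreover have "(D (Suc k))\<^sup>2 = X + Y"
    by (simp add: D_sq X_def Y_def)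
  moreover have "(D k)\<^sup>2 = (norm (x (k - 1) - x k))\<^sup>2 + (norm (y (k - 1) - y k))\<^sup>2"
    "(D (k - 1))\<^sup>2 = (norm (x (k - 2) - x (k - 1)))\<^sup>2 + (norm (y (k - 2) - y (k - 1)))\<^sup>2"
  proof -
    \<comment> \<open>Truncated subtraction makes this valid for \<open>k < 2\<close> too, so the
      initial indices need no separate case.\<close>
    have "k - 2 = k - 1 - 1"
      by simp
    then show "(D k)\<^sup>2 = (norm (x (k - 1) - x k))\<^sup>2 + (norm (y (k - 1) - y k))\<^sup>2"
      "(D (k - 1))\<^sup>2 = (norm (x (k - 2) - x (k - 1)))\<^sup>2 + (norm (y (k - 2) - y (k - 1)))\<^sup>2"
      unfolding D_sq by (simp_all only: norm_minus_commute)
  qed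
  ultimately show ?thesis
    by (simp add: h_def l_def a_def z_def algebra_simps add_divide_distrib diff_divide_distrib)
qed

lemma decseq_h: "decseq h"
proof (rule decseq_SucI)
  fix k
  have "0 \<le> a * (D (Suc k))\<^sup>2"
    using a_pos by simp
  then show "h (Suc k) \<le> h k"
    using decrease[of k] by linarith
qed

lemma l_le_h: "l k \<le> h k"
  using \<alpha>_nonneg by (simp add: h_def)

lemma l_bounded_below: "\<exists>B. \<forall>k. B \<le> l k"
proof -
  obtain B where B: "ereal B < (INF u. L u)"
    using ereal_dense2[OF inf_L] by auto
  have "ereal B \<le> L (z k)" for k
    using B INF_lower[of "z k" UNIV L] by (meson UNIV_I less_imp_le order_trans)
  then show ?thesis
    by (auto simp: L_z)
qed

lemma D_tendsto_0: "D \<longlonglongrightarrow> 0"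
proof -
  obtain B where B: "\<And>k. B \<le> l k"
    using l_bounded_below by blast
  show ?thesis
    using decrease a_pos order_trans[OF B l_le_h] by (rule prev_step_tendsto_zero)
qed

text \<open>All values \<open>l k\<close> stay below \<open>h 0\<close>, whereas coercivity pushes
  the objective above \<open>h 0\<close> outside some ball.\<close>

lemma bounded_z: "bounded (range z)"
proof -
  have "\<forall>\<^sub>F u in at_infinity. ereal (h 0) < L u"
    using coercive unfolding coercive_def by (rule order_tendstoD(1)) simp
  then obtain b where b: "\<And>u. b \<le> norm u \<Longrightarrow> ereal (h 0) < L u"
    by (auto simp: eventually_at_infinity)
  have "norm (z k) \<le> b" for k
  proof (rule ccontr)
    assume "\<not> norm (z k) \<le> b"
    then have "h 0 < l k"
      using b[of "z k"] by (simp add: L_z)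
    also have "\<dots> \<le> h 0"
      using l_le_h[of k] decseqD[OF decseq_h, of 0 k] by simp
    finally show False by simp
  qed
  then show ?thesis
    by (auto simp: bounded_iff)
qed

section \<open>Explicit subgradients of the objective and of the merit function\<close>

definition A :: "nat \<Rightarrow> 'a \<times> 'b" where
  "A k = grad Q (z (Suc k)) - (qx k + (grad \<phi>1 (x (Suc k)) - grad \<phi>1 (x k)),
      qy k + (grad \<phi>2 (y (Suc k)) - grad \<phi>2 (y k)))"

text \<open>Fermat's rule in each block gives subgradients of \<open>f\<close> and \<open>g\<close>.
  Stacked, they form one of the separable part, to which the full gradient of \<open>Q\<close> at
  the new point is added.\<close>

lemma A_in_subdiff: "A k \<in> frechet_subdiff L (z (Suc k))"
proof -
  let ?p = "z (Suc k)"
  have "(- (qx k + (grad \<phi>1 (x (Suc k)) - grad \<phi>1 (x k))), 0) \<in> frechet_subdiff (\<lambda>p. f (fst p)) ?p"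
    using bregman_step_subgradient[OF x_step f_x \<phi>1(1)] f_x[of "Suc k"]
    by (intro frechet_subdiff_fst) (auto simp: z_def)
  moreover have "(0, - (qy k + (grad \<phi>2 (y (Suc k)) - grad \<phi>2 (y k)))) \<in> frechet_subdiff (\<lambda>p. g (snd p)) ?p"
    using bregman_step_subgradient[OF y_step g_y \<phi>2(1)] g_y[of "Suc k"]
    by (intro frechet_subdiff_snd) (auto simp: z_def)
  ultimately have "(- (qx k + (grad \<phi>1 (x (Suc k)) - grad \<phi>1 (x k))), 0)
      + (0, - (qy k + (grad \<phi>2 (y (Suc k)) - grad \<phi>2 (y k))))
      \<in> frechet_subdiff (\<lambda>p. f (fst p) + g (snd p)) ?p" (is "?v \<in> _")
    by (intro frechet_subdiff_add[where r = "fx (Suc k)" and s = "gy (Suc k)"])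
      (simp_all add: z_def f_x g_y)
  then have "?v + grad Q ?p \<in> frechet_subdiff (\<lambda>p. f (fst p) + g (snd p) + ereal (Q p)) ?p"
    by (rule frechet_subdiff_add_smooth[where r = "fx (Suc k) + gy (Suc k)", rotated])
      (auto simp: z_def f_x g_y intro: GDERIV_grad Q_differentiable)
  moreover have "L = (\<lambda>p. f (fst p) + g (snd p) + ereal (Q p))"
    by (simp add: fun_eq_iff objective_def add_ac)
  moreover have "A k = ?v + grad Q ?p"
    by (simp add: A_def grad_Q_eq z_def)
  ultimately show ?thesis
    by simp
qed

lemma norm_x_le: "norm (x k - x (k - 1)) \<le> D k" and norm_y_le: "norm (y k - y (k - 1)) \<le> D k"
  using norm_fst_le[of "x k - x (k - 1)" "y k - y (k - 1)"]
    norm_snd_le[of "y k - y (k - 1)" "x k - x (k - 1)"]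
  by (simp_all add: prev_step_def z_def)

text \<open>Each block contains the difference between the gradient of \<open>Q\<close> at the new
  point and the one used in the subproblem. In the \<open>x\<close> block both arguments move, so
  the Lipschitz constant on the bounded set of iterates is used; in the \<open>y\<close> block only
  \<open>y\<close> moves and \<open>L2p\<close> suffices.\<close>

lemma norm_A_le: "\<exists>b\<ge>0. \<forall>k. norm (A k) \<le> b * (D (Suc k) + D k + D (k - 1))"
proof -
  obtain M where M: "M-lipschitz_on (range z) (grad Q)"
    using Q(2) bounded_z by (auto simp: lipschitz_on_bounded_def)
  define b where "b = M + L\<phi>1 + L\<phi>2 + L2p + 2 * \<alpha>1 + 2 * \<alpha>2"
  have nonneg: "0 \<le> M" "0 \<le> L\<phi>1" "0 \<le> L\<phi>2" "0 \<le> L2p"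
    using lipschitz_on_nonneg[OF M] lipschitz_on_nonneg[OF \<phi>1(3)] lipschitz_on_nonneg[OF \<phi>2(3)]
      lipschitz_on_nonneg[OF lip_y[of "x 0"]] Lp(2)[of 0] by auto
  have inertia: "norm (c *\<^sub>R u) \<le> \<alpha> * d" if "0 \<le> c" "c \<le> \<alpha>" "norm u \<le> d"
    for c \<alpha> d :: real and u :: "'c::real_normed_vector"
    using that by (auto intro!: mult_mono intro: order_trans[OF norm_ge_zero])
  have "norm (A k) \<le> b * (D (Suc k) + D k + D (k - 1))" for k
  proof -
    have "norm (grad Q (z (Suc k)) - grad Q (z k)) \<le> M * D (Suc k)"
      using lipschitz_onD[OF M, of "z (Suc k)" "z k"] by (simp add: dist_norm prev_step_def)
    then have Qx: "norm (grad_fst Q (x (Suc k)) (y (Suc k)) - grad_fst Q (x k) (y k)) \<le> M * D (Suc k)"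
      using norm_fst_le order_trans by (fastforce simp: z_def grad_Q_eq)
    have "norm (grad_snd Q (x (Suc k)) (y (Suc k)) - grad_snd Q (x (Suc k)) (y k))
        \<le> L2 (x (Suc k)) * norm (y (Suc k) - y k)"
      using lipschitz_onD[OF lip_y, of "y (Suc k)" "y k"] by (simp add: dist_norm)
    also have "\<dots> \<le> L2p * D (Suc k)"
      using Lp(2)[of "Suc k"] norm_y_le[of "Suc k"] nonneg by (intro mult_mono) auto
    finally have Qy: "norm (grad_snd Q (x (Suc k)) (y (Suc k)) - grad_snd Q (x (Suc k)) (y k))
        \<le> L2p * D (Suc k)" .
    have P1: "norm (grad \<phi>1 (x (Suc k)) - grad \<phi>1 (x k)) \<le> L\<phi>1 * D (Suc k)"
    proof -
      have "norm (grad \<phi>1 (x (Suc k)) - grad \<phi>1 (x k)) \<le> L\<phi>1 * norm (x (Suc k) - x k)"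
        using lipschitz_onD[OF \<phi>1(3), of "x (Suc k)" "x k"] by (simp add: dist_norm)
      also have "\<dots> \<le> L\<phi>1 * D (Suc k)"
        using norm_x_le[of "Suc k"] nonneg by (intro mult_left_mono) auto
      finally show ?thesis .
    qed
    have P2: "norm (grad \<phi>2 (y (Suc k)) - grad \<phi>2 (y k)) \<le> L\<phi>2 * D (Suc k)"
    proof -
      have "norm (grad \<phi>2 (y (Suc k)) - grad \<phi>2 (y k)) \<le> L\<phi>2 * norm (y (Suc k) - y k)"
        using lipschitz_onD[OF \<phi>2(3), of "y (Suc k)" "y k"] by (simp add: dist_norm)
      also have "\<dots> \<le> L\<phi>2 * D (Suc k)"
        using norm_y_le[of "Suc k"] nonneg by (intro mult_left_mono) auto
      finally show ?thesis .
    qed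
    have I: "norm (\<alpha>1s k *\<^sub>R (x (k - 1) - x k)) \<le> \<alpha>1 * D k"
      "norm (\<alpha>2s k *\<^sub>R (x (k - 2) - x (k - 1))) \<le> \<alpha>2 * D (k - 1)"
      "norm (\<beta>1s k *\<^sub>R (y (k - 1) - y k)) \<le> \<alpha>1 * D k"
      "norm (\<beta>2s k *\<^sub>R (y (k - 2) - y (k - 1))) \<le> \<alpha>2 * D (k - 1)"
      using norm_x_le[of k] norm_x_le[of "k - 1"] norm_y_le[of k] norm_y_le[of "k - 1"]
      by (intro inertia \<alpha>1s \<alpha>2s \<beta>1s \<beta>2s; simp add: norm_minus_commute numeral_2_eq_2)+
    have four: "norm (u - v - s - t) \<le> c1 + c2 + c3 + c4"
      if "norm u \<le> c1" "norm v \<le> c2" "norm s \<le> c3" "norm t \<le> c4"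
      for u v s t :: "'c::real_normed_vector" and c1 c2 c3 c4
      using that norm_triangle_ineq4[of u v] norm_triangle_ineq4[of "u - v" s]
        norm_triangle_ineq4[of "u - v - s" t] by linarith
    have "fst (A k) = (grad_fst Q (x (Suc k)) (y (Suc k)) - grad_fst Q (x k) (y k))
        - (grad \<phi>1 (x (Suc k)) - grad \<phi>1 (x k))
        - \<alpha>1s k *\<^sub>R (x (k - 1) - x k) - \<alpha>2s k *\<^sub>R (x (k - 2) - x (k - 1))"
      by (simp add: A_def grad_Q_eq z_def qx_def)
    then have A1: "norm (fst (A k)) \<le> M * D (Suc k) + L\<phi>1 * D (Suc k) + \<alpha>1 * D k + \<alpha>2 * D (k - 1)"
      using four[OF Qx P1 I(1,2)] by simp
    have "snd (A k) = (grad_snd Q (x (Suc k)) (y (Suc k)) - grad_snd Q (x (Suc k)) (y k))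
        - (grad \<phi>2 (y (Suc k)) - grad \<phi>2 (y k))
        - \<beta>1s k *\<^sub>R (y (k - 1) - y k) - \<beta>2s k *\<^sub>R (y (k - 2) - y (k - 1))"
      by (simp add: A_def grad_Q_eq z_def qy_def)
    then have A2: "norm (snd (A k)) \<le> L2p * D (Suc k) + L\<phi>2 * D (Suc k) + \<alpha>1 * D k + \<alpha>2 * D (k - 1)"
      using four[OF Qy P2 I(3,4)] by simp
    have "norm (A k) \<le> norm (fst (A k)) + norm (snd (A k))"
      by (metis norm_Pair_le prod.collapse)
    also have "\<dots> \<le> (M + L\<phi>1 + L2p + L\<phi>2) * D (Suc k) + (2 * \<alpha>1) * D k + (2 * \<alpha>2) * D (k - 1)"
      using A1 A2 by (simp add: algebra_simps)
    also have "\<dots> \<le> b * D (Suc k) + b * D k + b * D (k - 1)"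
      using nonneg \<alpha>_nonneg by (intro add_mono mult_right_mono prev_step_nonneg) (auto simp: b_def)
    finally show ?thesis
      by (simp add: distrib_left)
  qed
  moreover have "0 \<le> b"
    using nonneg \<alpha>_nonneg by (simp add: b_def)
  ultimately show ?thesis by blast
qed

text \<open>The subgradient \<open>A k\<close> in the first slot plus the gradients of both coupling
  terms at the lifted iterate.\<close>

definition W :: "nat \<Rightarrow> ('a \<times> 'b) \<times> ('a \<times> 'b) \<times> ('a \<times> 'b)" where
  "W k = (A k + (\<alpha>1 + \<alpha>2) *\<^sub>R (z (Suc k) - z k),
    \<alpha>2 *\<^sub>R (z k - z (k - 1)) - (\<alpha>1 + \<alpha>2) *\<^sub>R (z (Suc k) - z k),
    - \<alpha>2 *\<^sub>R (z k - z (k - 1)))"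

lemma W_in_subdiff: "W k \<in> frechet_subdiff H (lifted_seq z (Suc k))"
proof -
  let ?p = "lifted_seq z (Suc k)"
  let ?s1 = "\<lambda>p :: ('a \<times> 'b) \<times> ('a \<times> 'b) \<times> ('a \<times> 'b). (\<alpha>1 + \<alpha>2) / 2 * (norm (fst p - fst (snd p)))\<^sup>2"
  let ?s2 = "\<lambda>p :: ('a \<times> 'b) \<times> ('a \<times> 'b) \<times> ('a \<times> 'b). \<alpha>2 / 2 * (norm (fst (snd p) - snd (snd p)))\<^sup>2"
  have p: "fst ?p = z (Suc k)" "fst (snd ?p) = z k" "snd (snd ?p) = z (k - 1)"
    by (simp_all add: lifted_seq_def numeral_2_eq_2)
  have "(A k, 0) \<in> frechet_subdiff (\<lambda>p. L (fst p)) ?p"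
    by (rule frechet_subdiff_fst[where r = "l (Suc k)"]) (simp_all add: p L_z A_in_subdiff)
  moreover have "GDERIV ?s1 ?p :> ((\<alpha>1 + \<alpha>2) *\<^sub>R (z (Suc k) - z k), - (\<alpha>1 + \<alpha>2) *\<^sub>R (z (Suc k) - z k), 0)"
    using GDERIV_half_norm_sq_diff12[of "\<alpha>1 + \<alpha>2" ?p] unfolding p .
  ultimately have "(A k, 0) + ((\<alpha>1 + \<alpha>2) *\<^sub>R (z (Suc k) - z k), - (\<alpha>1 + \<alpha>2) *\<^sub>R (z (Suc k) - z k), 0)
      \<in> frechet_subdiff (\<lambda>p. L (fst p) + ereal (?s1 p)) ?p" (is "?v \<in> _")
    by (rule frechet_subdiff_add_smooth[where F = "\<lambda>p. L (fst p)" and s = ?s1 and r = "l (Suc k)", rotated])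
      (simp add: p L_z)
  moreover have "GDERIV ?s2 ?p :> (0, \<alpha>2 *\<^sub>R (z k - z (k - 1)), - \<alpha>2 *\<^sub>R (z k - z (k - 1)))"
    using GDERIV_half_norm_sq_diff23[of \<alpha>2 ?p] unfolding p .
  ultimately have "?v + (0, \<alpha>2 *\<^sub>R (z k - z (k - 1)), - \<alpha>2 *\<^sub>R (z k - z (k - 1)))
      \<in> frechet_subdiff (\<lambda>p. L (fst p) + ereal (?s1 p) + ereal (?s2 p)) ?p"
    by (rule frechet_subdiff_add_smooth[where F = "\<lambda>p. L (fst p) + ereal (?s1 p)" and s = ?s2
          and r = "l (Suc k) + ?s1 ?p", rotated])
      (simp add: p L_z)
  moreover have "H = (\<lambda>p. L (fst p) + ereal (?s1 p) + ereal (?s2 p))"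
    by (simp add: fun_eq_iff merit_def)
  moreover have "W k = ?v + (0, \<alpha>2 *\<^sub>R (z k - z (k - 1)), - \<alpha>2 *\<^sub>R (z k - z (k - 1)))"
    by (simp add: W_def zero_prod_def algebra_simps)
  ultimately show ?thesis
    by simp
qed

lemma norm_W_le: "\<exists>b>0. \<forall>k. norm (W k) \<le> b * (D (Suc k) + D k + D (k - 1))"
proof -
  obtain b where b: "0 \<le> b" "\<And>k. norm (A k) \<le> b * (D (Suc k) + D k + D (k - 1))"
    using norm_A_le by blast
  \<comment> \<open>Each coupling gradient occurs in two slots, hence the factor 2; the summand 1
    makes \<open>b + c\<close> strictly positive.\<close>
  define c where "c = 1 + 2 * (\<alpha>1 + \<alpha>2)"
  have "norm (W k) \<le> (b + c) * (D (Suc k) + D k + D (k - 1))" for k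
  proof -
    define v w where "v = (\<alpha>1 + \<alpha>2) *\<^sub>R (z (Suc k) - z k)" and "w = \<alpha>2 *\<^sub>R (z k - z (k - 1))"
    have vw: "norm v = (\<alpha>1 + \<alpha>2) * D (Suc k)" "norm w = \<alpha>2 * D k"
      using \<alpha>_nonneg by (simp_all add: v_def w_def prev_step_def)
    have "W k = (A k + v, w - v, - w)"
      by (simp add: W_def v_def w_def)
    then have "norm (W k) \<le> norm (A k + v) + (norm (w - v) + norm (- w))"
      using norm_Pair_le[of "A k + v" "(w - v, - w)"] norm_Pair_le[of "w - v" "- w"] by simp
    also have "\<dots> \<le> norm (A k) + 2 * norm v + 2 * norm w"
      using norm_triangle_ineq[of "A k" v] norm_triangle_ineq4[of w v] by simp
    also have "\<dots> \<le> b * (D (Suc k) + D k + D (k - 1)) + (c * D (Suc k) + c * D k + c * D (k - 1))"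
    proof -
      have "(2 * (\<alpha>1 + \<alpha>2)) * D (Suc k) \<le> c * D (Suc k)" "(2 * \<alpha>2) * D k \<le> c * D k"
        "0 \<le> c * D (k - 1)"
        using \<alpha>_nonneg by (intro mult_right_mono mult_nonneg_nonneg prev_step_nonneg; simp add: c_def)+
      with b(2)[of k] show ?thesis
        unfolding vw mult.assoc by linarith
    qed
    finally show ?thesis
      by (simp add: algebra_simps)
  qed
  moreover have "0 < b + c"
    using b(1) \<alpha>_nonneg by (simp add: c_def)
  ultimately show ?thesis by blast
qed

section \<open>Limits along subsequences and criticality\<close>

lemma z_pred_tendsto:
  assumes "filterlim t at_top sequentially" "(\<lambda>j. z (t j)) \<longlonglongrightarrow> p"
  shows "(\<lambda>j. z (t j - 1)) \<longlonglongrightarrow> p"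
proof -
  have "(\<lambda>j. D (t j)) \<longlonglongrightarrow> 0"
    using D_tendsto_0 assms(1) by (rule filterlim_compose)
  then have "(\<lambda>j. z (t j) - z (t j - 1)) \<longlonglongrightarrow> 0"
    unfolding prev_step_def by (rule tendsto_norm_zero_cancel)
  from tendsto_diff[OF assms(2) this] show ?thesis
    by simp
qed

lemma lifted_tendsto:
  assumes t: "filterlim t at_top sequentially" "(\<lambda>j. z (t j)) \<longlonglongrightarrow> p"
  shows "(\<lambda>j. lifted_seq z (t j)) \<longlonglongrightarrow> (p, p, p)"
proof -
  have "(\<lambda>j. z (t j - 1)) \<longlonglongrightarrow> p"
    using t by (rule z_pred_tendsto)
  moreover from this have "(\<lambda>j. z (t j - 1 - 1)) \<longlonglongrightarrow> p"
    by (rule z_pred_tendsto[rotated])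
      (rule filterlim_compose[OF filterlim_minus_const_nat_at_top t(1)])
  ultimately show ?thesis
    unfolding lifted_seq_def using t(2) by (intro tendsto_Pair) (simp_all add: numeral_2_eq_2)
qed

text \<open>Only an iterate of successor index is known to be a minimiser, hence the shape
  \<open>Suc (s j)\<close>. Vanishing steps give its predecessors the same limit, so the data of the
  subproblems converge as well.\<close>

lemma L_tendsto_Suc:
  assumes s: "filterlim s at_top sequentially" and lim: "(\<lambda>j. z (Suc (s j))) \<longlonglongrightarrow> p"
  shows "(\<lambda>j. L (z (Suc (s j)))) \<longlonglongrightarrow> L p"
proof -
  obtain u v where p: "p = (u, v)" by fastforce
  have Suc_s: "filterlim (\<lambda>j. Suc (s j)) at_top sequentially"
    using s by (rule filterlim_compose[OF filterlim_Suc])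
  have lim': "(\<lambda>j. z (s j)) \<longlonglongrightarrow> p"
    using z_pred_tendsto[OF Suc_s lim] by simp
  have lim1: "(\<lambda>j. z (s j - 1)) \<longlonglongrightarrow> p" "(\<lambda>j. z (s j - 2)) \<longlonglongrightarrow> p"
    using lifted_tendsto[OF s lim', THEN tendsto_snd, THEN tendsto_fst]
      lifted_tendsto[OF s lim', THEN tendsto_snd, THEN tendsto_snd]
    by (simp_all add: lifted_seq_def)
  note x_lim = lim[THEN tendsto_fst] lim'[THEN tendsto_fst] lim1[THEN tendsto_fst]
  note y_lim = lim[THEN tendsto_snd] lim'[THEN tendsto_snd] lim1[THEN tendsto_snd]
  \<comment> \<open>Facts 1 to 4 concern \<open>x\<close> at the indices \<open>Suc (s j)\<close>,
    \<open>s j\<close>, \<open>s j - 1\<close>, \<open>s j - 2\<close>; facts 5 to 8 are the same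
    for \<open>y\<close>.\<close>
  note lims = x_lim[unfolded z_def p fst_conv] y_lim[unfolded z_def p snd_conv]
  have cont: "isCont (grad Q) p"
    using Q(1) unfolding C1_def by (meson continuous_on_eq_continuous_at iso_tuple_UNIV_I open_UNIV)
  have "(\<lambda>j. grad Q (x (s j), y (s j))) \<longlonglongrightarrow> grad Q p"
    using lim' unfolding z_def by (rule isCont_tendsto_compose[OF cont])
  from tendsto_fst[OF this] have gx: "(\<lambda>j. grad_fst Q (x (s j)) (y (s j))) \<longlonglongrightarrow> fst (grad Q p)"
    by (simp add: grad_Q_eq)
  have "(\<lambda>j. grad Q (x (Suc (s j)), y (s j))) \<longlonglongrightarrow> grad Q p"
    unfolding p by (rule isCont_tendsto_compose[OF cont[unfolded p]]) (intro tendsto_Pair lims)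
  from tendsto_snd[OF this] have gy: "(\<lambda>j. grad_snd Q (x (Suc (s j))) (y (s j))) \<longlonglongrightarrow> snd (grad Q p)"
    by (simp add: grad_Q_eq)
  have "(\<lambda>j. qx (s j)) \<longlonglongrightarrow> fst (grad Q p) + 0 + 0"
    unfolding qx_def
    by (intro tendsto_add gx scaleR_bounded_tendsto_0[OF \<alpha>1s] scaleR_bounded_tendsto_0[OF \<alpha>2s])
      (use tendsto_diff[OF lims(3,2)] tendsto_diff[OF lims(4,3)] in simp_all)
  with lims have "(\<lambda>j. f (x (Suc (s j)))) \<longlonglongrightarrow> f u"
    by (intro bregman_step_value_tendsto[OF x_step f(2) not_MInf(1) \<phi>1(1)
          lipschitz_on_continuous_on[OF \<phi>1(3)]])
  moreover have "(\<lambda>j. qy (s j)) \<longlonglongrightarrow> snd (grad Q p) + 0 + 0"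
    unfolding qy_def
    by (intro tendsto_add gy scaleR_bounded_tendsto_0[OF \<beta>1s] scaleR_bounded_tendsto_0[OF \<beta>2s])
      (use tendsto_diff[OF lims(7,6)] tendsto_diff[OF lims(8,7)] in simp_all)
  with lims have "(\<lambda>j. g (y (Suc (s j)))) \<longlonglongrightarrow> g v"
    by (intro bregman_step_value_tendsto[OF y_step g(2) not_MInf(2) \<phi>2(1)
          lipschitz_on_continuous_on[OF \<phi>2(3)]])
  moreover have "(\<lambda>j. ereal (Q (z (Suc (s j))))) \<longlonglongrightarrow> ereal (Q p)"
    using isCont_tendsto_compose[OF differentiable_imp_continuous_within[OF Q_differentiable] lim]
    by simp
  \<comment> \<open>At this stage \<open>f u\<close> and \<open>g v\<close> might still be infinite,
    but never minus infinity, so addition is continuous here.\<close>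
  ultimately have "(\<lambda>j. f (x (Suc (s j))) + ereal (Q (z (Suc (s j)))) + g (y (Suc (s j))))
      \<longlonglongrightarrow> f u + ereal (Q p) + g v"
    using not_MInf by (intro tendsto_add_ereal_general) auto
  then show ?thesis
    by (simp add: objective_def z_def p)
qed

text \<open>The limit value is finite because it lies between a lower bound of the objective and
  \<open>h 0\<close>. The coupling terms of \<open>h\<close> vanish with the steps.\<close>

lemma cluster_value:
  assumes r: "strict_mono r" and lim: "(\<lambda>j. z (r j)) \<longlonglongrightarrow> p"
  obtains c where "L p = ereal c" "H (p, p, p) = ereal c"
    "(\<lambda>j. l (r j)) \<longlonglongrightarrow> c" "(\<lambda>j. h (r j)) \<longlonglongrightarrow> c"
proof -
  have r_top: "filterlim r at_top sequentially"
    using r by (rule filterlim_subseq)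
  \<comment> \<open>Dropping the first term excludes the index 0, since \<open>r 0\<close> may be 0
    and the starting point need not be a minimiser.\<close>
  have r_Suc: "Suc (r (Suc j) - 1) = r (Suc j)" for j
    using seq_suble[OF r, of "Suc j"] by simp
  have "(\<lambda>j. L (z (Suc (r (Suc j) - 1)))) \<longlonglongrightarrow> L p"
  proof (rule L_tendsto_Suc)
    show "filterlim (\<lambda>j. r (Suc j) - 1) at_top sequentially"
      by (rule filterlim_compose[OF filterlim_minus_const_nat_at_top]
          filterlim_compose[OF r_top filterlim_Suc])+
    show "(\<lambda>j. z (Suc (r (Suc j) - 1))) \<longlonglongrightarrow> p"
      unfolding r_Suc using lim by (rule LIMSEQ_Suc)
  qed
  then have L_lim: "(\<lambda>j. ereal (l (r j))) \<longlonglongrightarrow> L p"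
    unfolding r_Suc L_z by (rule LIMSEQ_imp_Suc)
  obtain B where B: "\<And>k. B \<le> l k"
    using l_bounded_below by blast
  have "ereal B \<le> L p"
    by (rule LIMSEQ_le_const[OF L_lim]) (simp add: B)
  moreover have "L p \<le> ereal (h 0)"
    by (rule LIMSEQ_le_const2[OF L_lim])
      (auto intro!: exI[of _ 0] order_trans[OF l_le_h] decseqD[OF decseq_h])
  ultimately obtain c where c: "L p = ereal c"
    by (cases "L p") auto
  have l_lim: "(\<lambda>j. l (r j)) \<longlonglongrightarrow> c"
    using L_lim by (simp add: c)
  have D_lim: "(\<lambda>j. D (r j)) \<longlonglongrightarrow> 0" "(\<lambda>j. D (r j - 1)) \<longlonglongrightarrow> 0"
    by (rule filterlim_compose[OF D_tendsto_0] filterlim_compose[OF filterlim_minus_const_nat_at_top] r_top)+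
  have "(\<lambda>j. h (r j)) \<longlonglongrightarrow> c + (\<alpha>1 + \<alpha>2) / 2 * 0\<^sup>2 + \<alpha>2 / 2 * 0\<^sup>2"
    unfolding h_def by (intro tendsto_intros l_lim D_lim)
  moreover have "H (p, p, p) = ereal c"
    by (simp add: merit_def c)
  ultimately show thesis
    using that c l_lim by simp
qed

text \<open>The explicit subgradients tend to 0 with the steps while points and values converge, so
  the sequences themselves witness membership of 0 in the limiting subdifferentials.\<close>

lemma critical_points:
  assumes lim: "z \<longlonglongrightarrow> p"
  shows "critical_point H (p, p, p)" "critical_point L p"
proof -
  obtain c where c: "L p = ereal c" "H (p, p, p) = ereal c" "l \<longlonglongrightarrow> c" "h \<longlonglongrightarrow> c"
    using cluster_value[of id p] lim strict_mono_id unfolding id_apply by blast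
  have to_0: "(\<lambda>k. b * (D (Suc k) + D k + D (k - 1))) \<longlonglongrightarrow> 0" for b
  proof -
    have "(\<lambda>k. b * (D (Suc k) + D k + D (k - 1))) \<longlonglongrightarrow> b * (0 + 0 + 0)"
      by (intro tendsto_intros LIMSEQ_Suc[OF D_tendsto_0] D_tendsto_0
          filterlim_compose[OF D_tendsto_0 filterlim_minus_const_nat_at_top])
    then show ?thesis by simp
  qed
  obtain b where "\<forall>k. norm (A k) \<le> b * (D (Suc k) + D k + D (k - 1))"
    using norm_A_le by blast
  then have "A \<longlonglongrightarrow> 0"
    by (rule Lim_null_comparison[OF always_eventually to_0])
  moreover have "(\<lambda>k. L (z (Suc k))) \<longlonglongrightarrow> L p"
    using LIMSEQ_Suc[OF c(3)] by (simp add: L_z c(1))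
  ultimately show "critical_point L p"
    unfolding critical_point_def limiting_subdiff_def mem_Collect_eq
    using A_in_subdiff LIMSEQ_Suc[OF lim]
    by (intro conjI exI[of _ "\<lambda>k. z (Suc k)"] exI[of _ A]) (auto simp: edom_def c)
  obtain b' where "\<forall>k. norm (W k) \<le> b' * (D (Suc k) + D k + D (k - 1))"
    using norm_W_le by blast
  then have "W \<longlonglongrightarrow> 0"
    by (rule Lim_null_comparison[OF always_eventually to_0])
  moreover have "(\<lambda>k. H (lifted_seq z (Suc k))) \<longlonglongrightarrow> H (p, p, p)"
    using LIMSEQ_Suc[OF c(4)] by (simp add: H_lifted c(2))
  moreover have "(\<lambda>k. lifted_seq z (Suc k)) \<longlonglongrightarrow> (p, p, p)"
    using filterlim_Suc LIMSEQ_Suc[OF lim] by (rule lifted_tendsto)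
  ultimately show "critical_point H (p, p, p)"
    unfolding critical_point_def limiting_subdiff_def mem_Collect_eq
    using W_in_subdiff
    by (intro conjI exI[of _ "\<lambda>k. lifted_seq z (Suc k)"] exI[of _ W]) (auto simp: edom_def c)
qed

lemma convergent_subsequence:
  "\<exists>r p. strict_mono r \<and> (\<lambda>j. lifted_seq z (r j)) \<longlonglongrightarrow> p \<and> (\<lambda>j. H (lifted_seq z (r j))) \<longlonglongrightarrow> H p"
proof -
  obtain p r where r: "strict_mono r" "(z \<circ> r) \<longlonglongrightarrow> p"
    using bounded_imp_convergent_subsequence[OF bounded_z] by blast
  then have lim: "(\<lambda>j. z (r j)) \<longlonglongrightarrow> p"
    by (simp add: o_def)
  obtain c where "H (p, p, p) = ereal c" "(\<lambda>j. h (r j)) \<longlonglongrightarrow> c"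
    using cluster_value[OF r(1) lim] by metis
  then have "(\<lambda>j. H (lifted_seq z (r j))) \<longlonglongrightarrow> H (p, p, p)"
    by (simp add: H_lifted)
  then show ?thesis
    using r(1) lifted_tendsto[OF filterlim_subseq[OF r(1)] lim] by blast
qed

lemma finite_length:
  assumes cluster: "seq_cluster_point (\<lambda>k. (z (k + 1), z k, z (k - 1))) (p, p, p)"
    and KL: "KL_property H (p, p, p)"
  shows "summable (\<lambda>k. norm (z (k + 1) - z k))" "z \<longlonglongrightarrow> p"
proof -
  obtain r where r: "strict_mono r"
      "((\<lambda>k. (z (k + 1), z k, z (k - 1))) \<circ> r) \<longlonglongrightarrow> (p, p, p)"
    using cluster by (auto simp: seq_cluster_point_def)
  \<comment> \<open>The triple in the cluster hypothesis at \<open>k\<close> is the lifted sequence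
    at \<open>k + 1\<close>.\<close>
  define s where "s j = Suc (r j)" for j
  have s: "strict_mono s"
    using r(1) by (simp add: s_def strict_mono_def)
  have lift: "(\<lambda>j. lifted_seq z (s j)) \<longlonglongrightarrow> (p, p, p)"
    using r(2) by (simp add: o_def lifted_seq_def s_def numeral_2_eq_2)
  then have "(\<lambda>j. z (s j)) \<longlonglongrightarrow> p"
    using tendsto_fst[OF lift] by (simp add: lifted_seq_def)
  then obtain c where c: "H (p, p, p) = ereal c" "(\<lambda>j. h (s j)) \<longlonglongrightarrow> c"
    using cluster_value[OF s] by metis
  obtain b where b: "0 < b" "\<And>k. norm (W k) \<le> b * (D (Suc k) + D k + D (k - 1))"
    using norm_W_le by blast
  have sub: "\<exists>w \<in> limiting_subdiff H (lifted_seq z (Suc k)).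
      norm w \<le> b * (D (Suc k) + D k + D (k - 1))" for k
    using b(2) W_in_subdiff frechet_subset_limiting_subdiff by blast
  note KL_facts = KL H_lifted c(1) decrease a_pos b(1) sub s lift c(2)
  have "summable D"
    by (rule KL_finite_length(1)[OF KL_facts])
  then have "summable (\<lambda>k. D (Suc k))"
    by (simp only: summable_Suc_iff)
  then show "summable (\<lambda>k. norm (z (k + 1) - z k))"
    by (simp add: prev_step_def)
  show "z \<longlonglongrightarrow> p"
    by (rule KL_finite_length(2)[OF KL_facts])
qed

end

theorem theorem3p1:
  fixes f :: "real ^ 'l \<Rightarrow> ereal"
    and g :: "real ^ 'm \<Rightarrow> ereal"
    and Q :: "(real ^ 'l) \<times> (real ^ 'm) \<Rightarrow> real"
    and L :: "(real ^ 'l) \<times> (real ^ 'm) \<Rightarrow> ereal"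
    and \<phi>1 :: "real ^ 'l \<Rightarrow> real" and \<phi>2 :: "real ^ 'm \<Rightarrow> real"
    and \<theta>1 \<theta>2 L\<phi>1 L\<phi>2 \<alpha>1 \<alpha>2 L1p L2p \<rho> :: real
    and \<alpha>1s \<alpha>2s \<beta>1s \<beta>2s :: "nat \<Rightarrow> real"
    and L1 :: "real ^ 'm \<Rightarrow> real" and L2 :: "real ^ 'l \<Rightarrow> real"
    and x :: "nat \<Rightarrow> real ^ 'l" and y :: "nat \<Rightarrow> real ^ 'm"
    and z :: "nat \<Rightarrow> (real ^ 'l) \<times> (real ^ 'm)"
    and H :: "((real ^ 'l) \<times> (real ^ 'm)) \<times> ((real ^ 'l) \<times> (real ^ 'm)) \<times> ((real ^ 'l) \<times> (real ^ 'm)) \<Rightarrow> ereal"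
  assumes L_eq: "L = objective f Q g"
    and f: "proper_fun f" "lsc f"
    and g: "proper_fun g" "lsc g"
    and Q: "C1 Q" "lipschitz_on_bounded (grad Q)"
    and inf_L: "(INF u. L u) > -\<infinity>"
    and inf_f: "(INF u. f u) > -\<infinity>"
    and inf_g: "(INF u. g u) > -\<infinity>"
    and phi1: "\<And>u. \<phi>1 differentiable (at u)" "\<theta>1 > 0" "strongly_convex \<theta>1 \<phi>1"
      "L\<phi>1-lipschitz_on UNIV (grad \<phi>1)"
    and phi2: "\<And>u. \<phi>2 differentiable (at u)" "\<theta>2 > 0" "strongly_convex \<theta>2 \<phi>2"
      "L\<phi>2-lipschitz_on UNIV (grad \<phi>2)"
    and alpha: "\<alpha>1 \<ge> 0" "\<alpha>2 \<ge> 0"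
      "\<And>k. \<alpha>1s k \<in> {0..\<alpha>1}" "\<And>k. \<beta>1s k \<in> {0..\<alpha>1}"
      "\<And>k. \<alpha>2s k \<in> {0..\<alpha>2}" "\<And>k. \<beta>2s k \<in> {0..\<alpha>2}"
    and scheme: "inertial_scheme f Q g \<phi>1 \<phi>2 \<alpha>1s \<alpha>2s \<beta>1s \<beta>2s x y"
    and z_eq: "z = (\<lambda>k. (x k, y k))"
    and lip_x: "\<And>v. (L1 v)-lipschitz_on UNIV (\<lambda>u. grad_fst Q u v)"
    and lip_y: "\<And>u. (L2 u)-lipschitz_on UNIV (\<lambda>v. grad_snd Q u v)"
    and Lp: "L1p > 0" "L2p > 0" "\<And>k. L1 (y k) \<le> L1p" "\<And>k. L2 (x k) \<le> L2p"
      "\<theta>1 > L1p" "\<theta>2 > L2p"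
    and rho: "\<rho> = min (\<theta>1 - L1p) (\<theta>2 - L2p)" "2 * (\<alpha>1 + \<alpha>2) < \<rho>"
    and coercive_L: "coercive L"
    and H_eq: "H = merit \<alpha>1 \<alpha>2 L"
  shows
    "(\<exists>a>0. \<exists>b>0.
        (\<forall>k. H (lifted_seq z (k + 1)) + ereal (a * (prev_step z (k + 1))\<^sup>2) \<le> H (lifted_seq z k)) \<and>
        (\<forall>k. \<exists>w \<in> limiting_subdiff H (lifted_seq z (k + 1)).
           norm w \<le> b * (prev_step z (k + 1) + prev_step z k + prev_step z (k - 1))) \<and>
        (\<exists>r p. strict_mono r \<and> (\<lambda>j. lifted_seq z (r j)) \<longlonglongrightarrow> p \<and>
           (\<lambda>j. H (lifted_seq z (r j))) \<longlonglongrightarrow> H p))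
     \<and> (\<forall>zs. seq_cluster_point (\<lambda>k. (z (k + 1), z k, z (k - 1))) (zs, zs, zs) \<longrightarrow>
           KL_property H (zs, zs, zs) \<longrightarrow>
           summable (\<lambda>k. norm (z (k + 1) - z k)) \<and>
           z \<longlonglongrightarrow> zs \<and>
           critical_point H (zs, zs, zs) \<and>
           critical_point L zs)"
proof -
  \<comment> \<open>The minimum defining \<open>\<rho>\<close> yields the two upper bounds on
    \<open>\<rho>\<close> that the locale asks for.\<close>
  interpret S: inertial_bpalm f g Q \<phi>1 \<phi>2 \<theta>1 \<theta>2 L\<phi>1 L\<phi>2 \<alpha>1 \<alpha>2 L1p L2p \<rho> \<alpha>1s \<alpha>2s \<beta>1s \<beta>2s L1 L2 x y
    by unfold_locales (use assms in \<open>auto simp: L_eq\<close>)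
  have z: "z = S.z"
    by (simp add: z_eq S.z_def fun_eq_iff)
  obtain b where b: "0 < b" "\<And>k. norm (S.W k) \<le> b * (S.D (Suc k) + S.D k + S.D (k - 1))"
    using S.norm_W_le by blast
  have "H (lifted_seq z (k + 1)) + ereal (S.a * (prev_step z (k + 1))\<^sup>2) \<le> H (lifted_seq z k)" for k
    using S.decrease[of k] by (simp add: z H_eq L_eq S.H_lifted)
  moreover have "\<exists>w \<in> limiting_subdiff H (lifted_seq z (k + 1)).
      norm w \<le> b * (prev_step z (k + 1) + prev_step z k + prev_step z (k - 1))" for k
    using b(2)[of k] frechet_subset_limiting_subdiff[OF S.W_in_subdiff[of k]]
    by (auto simp: z H_eq L_eq)
  moreover have "\<exists>r p. strict_mono r \<and> (\<lambda>j. lifted_seq z (r j)) \<longlonglongrightarrow> p \<and>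
      (\<lambda>j. H (lifted_seq z (r j))) \<longlonglongrightarrow> H p"
    using S.convergent_subsequence unfolding z H_eq L_eq .
  moreover have "summable (\<lambda>k. norm (z (k + 1) - z k)) \<and> z \<longlonglongrightarrow> zs \<and>
      critical_point H (zs, zs, zs) \<and> critical_point L zs"
    if "seq_cluster_point (\<lambda>k. (z (k + 1), z k, z (k - 1))) (zs, zs, zs)"
      "KL_property H (zs, zs, zs)" for zs
    using S.finite_length[of zs] S.critical_points[of zs] that unfolding z H_eq L_eq by blast
  ultimately show ?thesis
    using S.a_pos b(1) by blast
qed

end
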